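(* There exist a constant $c>0$ and a class of matroids $\mathcal{N}$ containing asymptotically almost all matroids, such that for all $n$ and all $0\le r\le n$, $$\log_2 \left|\{U(M): M\in \mathbb{M}_{n,r}\cap \mathcal{N}\}\right|\le c\,\frac{(\log_2 n)^3}{n^2}\binom{n}{\lfloor n/2\rfloor}.$$
   Context: For $n\ge 0$ let $[n]=\{1,\dots,n\}$, let $\mathbb{M}_{n,r}$ be the set of matroids with ground set $[n]$ and rank $r$, $\mathbb{M}_n=\bigcup_r\mathbb{M}_{n,r}$, and $\mathbb{M}=\bigcup_n\mathbb{M}_n$. A class $\mathcal{N}\subseteq\mathbb{M}$ contains asymptotically almost all matroids if $|\mathcal{N}\cap\mathbb{M}_n|/|\mathbb{M}_n|\to 1$ as $n\to\infty$. For a matroid $M$ of rank $r$ on $E$, the non-bases of $M$ are the $r$-element subsets of $E$ that are not bases; $W(M)$ denotes the set of circuit-hyperplanes of $M$ (subsets that are both a circuit and a hyperplane), and $U(M)$ denotes the set of non-bases of $M$ that are not circuit-hyperplanes. *)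

theory Defs imports Complex_Main begin

record 'a set_system =
  ground :: "'a set"
  indeps :: "'a set set"

definition matroid :: "'a set_system \<Rightarrow> bool" where
  "matroid M \<longleftrightarrow>
     finite (ground M) \<and>
     indeps M \<subseteq> Pow (ground M) \<and>
     {} \<in> indeps M \<and>
     (\<forall>X\<in>indeps M. \<forall>Y\<subseteq>X. Y \<in> indeps M) \<and>
     (\<forall>X\<in>indeps M. \<forall>Y\<in>indeps M. card X < card Y \<longrightarrow>
        (\<exists>y\<in>Y - X. insert y X \<in> indeps M))"

definition bases :: "'a set_system \<Rightarrow> 'a set set" where
  "bases M = {B \<in> indeps M. \<forall>X\<in>indeps M. B \<subseteq> X \<longrightarrow> X = B}"

definition circuits :: "'a set_system \<Rightarrow> 'a set set" where
  "circuits M = {C. C \<subseteq> ground M \<and> C \<notin> indeps M \<and> (\<forall>X. X \<subset> C \<longrightarrow> X \<in> indeps M)}"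

definition rank_of :: "'a set_system \<Rightarrow> 'a set \<Rightarrow> nat" where
  "rank_of M X = Max (card ` {I \<in> indeps M. I \<subseteq> X})"

abbreviation rank :: "'a set_system \<Rightarrow> nat" where
  "rank M \<equiv> rank_of M (ground M)"

definition closure :: "'a set_system \<Rightarrow> 'a set \<Rightarrow> 'a set" where
  "closure M X = {x \<in> ground M. rank_of M (insert x X) = rank_of M X}"

definition flats :: "'a set_system \<Rightarrow> 'a set set" where
  "flats M = {F. F \<subseteq> ground M \<and> closure M F = F}"

text \<open>The rank condition avoids truncated subtraction: a matroid of rank 0 has no hyperplanes.\<close>

definition hyperplanes :: "'a set_system \<Rightarrow> 'a set set" where
  "hyperplanes M = {H \<in> flats M. rank_of M H + 1 = rank M}"

definition nonbases :: "'a set_system \<Rightarrow> 'a set set" where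
  "nonbases M = {X. X \<subseteq> ground M \<and> card X = rank M \<and> X \<notin> bases M}"

definition W :: "'a set_system \<Rightarrow> 'a set set" where
  "W M = circuits M \<inter> hyperplanes M"

definition U :: "'a set_system \<Rightarrow> 'a set set" where
  "U M = nonbases M - W M"

definition matroids_of_rank :: "nat \<Rightarrow> nat \<Rightarrow> nat set_system set" where
  "matroids_of_rank n r = {M. matroid M \<and> ground M = {1..n} \<and> rank M = r}"

definition matroids_on :: "nat \<Rightarrow> nat set_system set" where
  "matroids_on n = (\<Union>r. matroids_of_rank n r)"

definition all_matroids :: "nat set_system set" where
  "all_matroids = (\<Union>n. matroids_on n)"

definition almost_all_matroids :: "nat set_system set \<Rightarrow> bool" where
  "almost_all_matroids \<N> \<longleftrightarrow>
     (\<lambda>n. real (card (\<N> \<inter> matroids_on n)) / real (card (matroids_on n))) \<longlonglongrightarrow> 1"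

end

theory Submission
  imports Defs "HOL-Library.FuncSet" "HOL-Library.Disjoint_Sets" "HOL-Real_Asymp.Real_Asymp"
begin

text \<open>A nonbasis is a circuit-hyperplane iff it has no nonbasis among its neighbours in the Johnson
  graph, so \<open>U(M)\<close> consists of the non-isolated vertices of the graph induced on the nonbases. Let
  \<open>N\<close> be the central binomial coefficient. Around a vertex of \<open>U(M)\<close> the nonbases are described by
  one circuit and one hyperplane, unless all neighbours are nonbases. Picking vertices of large
  degree greedily, \<open>O(N log n / n\<^sup>2)\<close> such local descriptions cover \<open>U(M)\<close> up to a remainder of
  maximum degree at most \<open>n/8\<close>; as unordered families of subsets of \<open>[n]\<close> they cost
  \<open>O(N log\<^sup>2 n / n\<^sup>2)\<close> bits, and listing all dependent sets and all sets meeting every basis of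
  size at most \<open>n/8\<close> costs less. Given these data, membership in the set of nonbases propagates along the
  edges of the remainder: if it failed at an edge, a circuit or cocircuit of size at most \<open>n/8\<close>
  would be present in one matroid and not in the other.

  Hence \<open>M\<close> is determined by the data, \<open>W(M)\<close> and one vertex of each of the \<open>k\<close> nontrivial components
  of the remainder. Together with \<open>W(M)\<close> these vertices form a stable set, that is, a sparse paving
  matroid, and there are at least \<open>2\<^sup>k\<close> ways to choose them. So \<open>k\<close> exceeds twice the bit size of the
  data for a vanishing fraction of the matroids only, and for the others \<open>U(M)\<close> is described by the
  data and \<open>k\<close> vertices at a cost of \<open>O(log n)\<close> bits each. Trivial components of the remainder belong
  to \<open>W(M)\<close> if \<open>M\<close> has no loops and coloops; matroids with a loop or coloop are rare, because each of
  them yields exponentially many principal extensions. Ranks outside \<open>[n/4, 3n/4]\<close> contribute too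
  few \<open>r\<close>-sets to matter.\<close>

section \<open>Matroids and circuit-hyperplanes\<close>

lemma matroidD:
  assumes "matroid M"
  shows "finite (ground M)" "indeps M \<subseteq> Pow (ground M)" "{} \<in> indeps M"
    "\<forall>X\<in>indeps M. \<forall>Y\<subseteq>X. Y \<in> indeps M"
    "\<forall>X\<in>indeps M. \<forall>Y\<in>indeps M. card X < card Y \<longrightarrow> (\<exists>y\<in>Y - X. insert y X \<in> indeps M)"
  using assms unfolding matroid_def by - (elim conjE, assumption)+

lemma indep_subset_ground: "matroid M \<Longrightarrow> X \<in> indeps M \<Longrightarrow> X \<subseteq> ground M"
  using matroidD(2)[of M] by auto

lemma indep_finite: "matroid M \<Longrightarrow> X \<in> indeps M \<Longrightarrow> finite X"
  by (rule finite_subset[OF indep_subset_ground matroidD(1)])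

lemma indep_mono: "matroid M \<Longrightarrow> X \<in> indeps M \<Longrightarrow> Y \<subseteq> X \<Longrightarrow> Y \<in> indeps M"
  using matroidD(4)[of M] by blast

lemma augment:
  "matroid M \<Longrightarrow> X \<in> indeps M \<Longrightarrow> Y \<in> indeps M \<Longrightarrow> card X < card Y \<Longrightarrow>
   \<exists>y\<in>Y - X. insert y X \<in> indeps M"
  using matroidD(5)[of M] by blast

lemma extend_indep:
  assumes M: "matroid M" and "X \<in> indeps M" "Y \<in> indeps M" "card X \<le> card Y"
  shows "\<exists>B\<in>indeps M. X \<subseteq> B \<and> B \<subseteq> X \<union> Y \<and> card B = card Y"
  using assms(2,4)
proof (induction "card Y - card X" arbitrary: X)
  case 0
  then show ?case by auto
next
  case (Suc k)
  then have "card X < card Y" by simp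
  then obtain y where y: "y \<in> Y - X" "insert y X \<in> indeps M"
    using augment[OF M Suc.prems(1) assms(3)] by blast
  have c: "card (insert y X) = Suc (card X)"
    using y indep_finite[OF M Suc.prems(1)] by simp
  have "\<exists>B\<in>indeps M. insert y X \<subseteq> B \<and> B \<subseteq> insert y X \<union> Y \<and> card B = card Y"
    using Suc.hyps(1)[of "insert y X"] Suc.hyps(2) y(2) c \<open>card X < card Y\<close> by simp
  then show ?case using y(1) by blast
qed

lemma finite_indeps: "matroid M \<Longrightarrow> finite (indeps M)"
  using matroidD(1,2)[of M] finite_subset[of "indeps M" "Pow (ground M)"] by simp

lemma rank_of_witness:
  assumes "matroid M"
  shows "\<exists>I\<in>indeps M. I \<subseteq> X \<and> card I = rank_of M X"
proof -
  have "finite (card ` {I \<in> indeps M. I \<subseteq> X})" using finite_indeps[OF assms] by simp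
  moreover have "card ` {I \<in> indeps M. I \<subseteq> X} \<noteq> {}" using matroidD(3)[OF assms] by auto
  ultimately have "rank_of M X \<in> card ` {I \<in> indeps M. I \<subseteq> X}"
    unfolding rank_of_def by (rule Max_in)
  then show ?thesis by auto
qed

lemma card_le_rank_of:
  assumes "matroid M" "I \<in> indeps M" "I \<subseteq> X"
  shows "card I \<le> rank_of M X"
  unfolding rank_of_def using finite_indeps[OF assms(1)] assms(2,3) by (intro Max_ge) auto

lemma rank_of_eqI:
  assumes "matroid M" "I \<in> indeps M" "I \<subseteq> X" "card I = k"
    and "\<And>J. J \<in> indeps M \<Longrightarrow> J \<subseteq> X \<Longrightarrow> card J \<le> k"
  shows "rank_of M X = k"
proof (rule le_antisym)
  show "rank_of M X \<le> k" using rank_of_witness[OF assms(1), of X] assms(5) by metis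
  show "k \<le> rank_of M X" using card_le_rank_of[OF assms(1-3)] assms(4) by simp
qed

section \<open>Nonbases as vertices of the Johnson graph\<close>

definition rsets :: "nat \<Rightarrow> nat \<Rightarrow> nat set set" where
  "rsets n r = {X. X \<subseteq> {1..n} \<and> card X = r}"

text \<open>Adjacency in the Johnson graph, written as one exchange so that no cardinality enters;
  neighbours of a finite set automatically have its size.\<close>

definition adj :: "'a set \<Rightarrow> 'a set \<Rightarrow> bool" where
  "adj X Y \<longleftrightarrow> (\<exists>x\<in>X. \<exists>y. y \<notin> X \<and> Y = insert y (X - {x}))"

lemma adj_sym: "adj X Y \<Longrightarrow> adj Y X"
proof -
  assume "adj X Y"
  then obtain x y where xy: "x \<in> X" "y \<notin> X" "Y = insert y (X - {x})" unfolding adj_def by blast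
  then have "y \<in> Y" "x \<notin> Y" "X = insert x (Y - {y})" by auto
  then show "adj Y X" unfolding adj_def by blast
qed

lemma adj_irrefl: "\<not> adj X X"
  unfolding adj_def by blast

lemma rsets_finite: "finite (rsets n r)"
  unfolding rsets_def by simp

lemma card_rsets: "card (rsets n r) = n choose r"
  unfolding rsets_def using n_subsets[of "{1..n}" r] by simp

lemma finite_rset: "X \<in> rsets n r \<Longrightarrow> finite X"
  unfolding rsets_def using finite_subset[of X "{1..n}"] by simp

lemma swap_rsets:
  assumes "X \<in> rsets n r" "x \<in> X" "y \<notin> X" "y \<in> {1..n}"
  shows "insert y (X - {x}) \<in> rsets n r"
proof -
  have "finite X" using finite_rset assms(1) by blast
  then have "card (insert y (X - {x})) = card X"
    using assms(2,3) card_Suc_Diff1[of X x] by simp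
  then show ?thesis using assms unfolding rsets_def by blast
qed

lemma matroids_of_rankD:
  assumes "M \<in> matroids_of_rank n r"
  shows "matroid M" "ground M = {1..n}" "rank M = r"
  using assms unfolding matroids_of_rank_def by auto

lemma matroids_of_rank_base:
  assumes "M \<in> matroids_of_rank n r"
  shows "\<exists>B\<in>indeps M. card B = r"
  using rank_of_witness[OF matroids_of_rankD(1)[OF assms]] matroids_of_rankD(3)[OF assms] by blast

lemma matroids_of_rank_card:
  assumes "M \<in> matroids_of_rank n r" "I \<in> indeps M"
  shows "card I \<le> r"
  using card_le_rank_of[of M I "ground M"] matroids_of_rankD[OF assms(1)] assms(2)
    indep_subset_ground[of M I] by simp

lemma nonbases_eq:
  assumes M: "M \<in> matroids_of_rank n r"
  shows "nonbases M = rsets n r - indeps M"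
proof -
  note m = matroids_of_rankD[OF M]
  have "X \<in> bases M \<longleftrightarrow> X \<in> indeps M" if "X \<in> rsets n r" for X
  proof
    assume "X \<in> indeps M"
    moreover have "Y = X" if "Y \<in> indeps M" "X \<subseteq> Y" for Y
      using card_seteq[of Y X] that indep_finite[OF m(1) that(1)] matroids_of_rank_card[OF M that(1)]
        \<open>X \<in> rsets n r\<close> unfolding rsets_def by auto
    ultimately show "X \<in> bases M" unfolding bases_def by blast
  qed (auto simp: bases_def)
  then show ?thesis unfolding nonbases_def using m by (auto simp: rsets_def)
qed

text \<open>Every independent set extends to one of size \<open>r\<close>, so the independent sets
  are the subsets of the \<open>r\<close>-sets outside \<open>nonbases\<close>.\<close>

lemma matroids_of_rank_eqI:
  assumes M: "M \<in> matroids_of_rank n r" and M': "M' \<in> matroids_of_rank n r"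
    and K: "nonbases M = nonbases M'"
  shows "M = M'"
proof -
  have sub: "indeps A \<subseteq> indeps B" if A: "A \<in> matroids_of_rank n r"
      and B: "B \<in> matroids_of_rank n r" and AB: "nonbases A = nonbases B" for A B :: "nat set_system"
  proof
    note a = matroids_of_rankD[OF A]
    fix I assume I: "I \<in> indeps A"
    obtain J where J: "J \<in> indeps A" "card J = r" using matroids_of_rank_base[OF A] by blast
    obtain Z where Z: "Z \<in> indeps A" "I \<subseteq> Z" "card Z = r"
      using extend_indep[OF a(1) I J(1)] matroids_of_rank_card[OF A I] J(2) by auto
    then have "Z \<in> rsets n r" using indep_subset_ground[OF a(1) Z(1)] a(2) unfolding rsets_def by auto
    then have "Z \<in> indeps B" using AB Z(1) unfolding nonbases_eq[OF A] nonbases_eq[OF B] by auto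
    then show "I \<in> indeps B" using indep_mono matroids_of_rankD(1)[OF B] Z(2) by blast
  qed
  have "indeps M = indeps M'" using sub[OF M M' K] sub[OF M' M K[symmetric]] by simp
  then show ?thesis using matroids_of_rankD(2)[OF M] matroids_of_rankD(2)[OF M'] by simp
qed

text \<open>If \<open>X\<close> is a circuit, each \<open>X - {x}\<close> is independent, and if it
  is a hyperplane, adding \<open>y\<close> raises the rank to \<open>r\<close>; augmenting
  \<open>X - {x}\<close> inside \<open>insert y X\<close> then makes \<open>X\<close> or its
  neighbour independent. Conversely, if all exchanges give bases, deletions from \<open>X\<close>
  are independent and additions have rank \<open>r\<close>; the bounds on \<open>r\<close> supply an
  element to delete and one to add.\<close>

lemma W_iff_isolated:
  assumes M: "M \<in> matroids_of_rank n r" and r: "0 < r" "r < n" and X: "X \<in> nonbases M"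
  shows "X \<in> W M \<longleftrightarrow> (\<forall>Y\<in>nonbases M. \<not> adj X Y)"
proof
  note m = matroids_of_rankD[OF M]
  have Xr: "X \<in> rsets n r" "X \<notin> indeps M" using X nonbases_eq[OF M] by auto
  then have Xs: "X \<subseteq> {1..n}" "card X = r" "finite X" using finite_rset[OF Xr(1)] by (simp_all add: rsets_def)
  {
    assume W: "X \<in> W M"
    show "\<forall>Y\<in>nonbases M. \<not> adj X Y"
    proof (intro ballI notI)
      fix Y assume Y: "Y \<in> nonbases M" "adj X Y"
      then obtain x y where xy: "x \<in> X" "y \<notin> X" "Y = insert y (X - {x})" unfolding adj_def by blast
      have Yn: "Y \<in> rsets n r" "Y \<notin> indeps M" using Y(1) nonbases_eq[OF M] by auto
      have yn: "y \<in> {1..n}" using xy Yn unfolding rsets_def by blast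
      have xi: "X - {x} \<in> indeps M" using W xy(1) unfolding W_def circuits_def by blast
      have rX: "rank_of M X + 1 = r" using W m(3) unfolding W_def hyperplanes_def by auto
      have "closure M X = X" using W unfolding W_def hyperplanes_def flats_def by auto
      then have "rank_of M (insert y X) \<noteq> rank_of M X"
        using xy(2) yn m(2) unfolding closure_def by auto
      moreover obtain I where I: "I \<in> indeps M" "I \<subseteq> insert y X" "card I = rank_of M (insert y X)"
        using rank_of_witness[OF m(1)] by blast
      moreover have "rank_of M X \<le> rank_of M (insert y X)"
            using rank_of_witness[OF m(1), of X] card_le_rank_of[OF m(1), of _ "insert y X"] by fastforce
      ultimately have "card (X - {x}) < card I" using rX Xs xy(1) by simp
      then obtain z where z: "z \<in> I - (X - {x})" "insert z (X - {x}) \<in> indeps M"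
        using augment[OF m(1) xi I(1)] by blast
      then have "z = x \<or> z = y" using I(2) by auto
      then show False using z(2) Xr(2) Yn(2) xy(1,3) by (auto simp: insert_absorb)
    qed
  }
  {
    assume iso: "\<forall>Y\<in>nonbases M. \<not> adj X Y"
    have swap: "insert y (X - {x}) \<in> indeps M" if "x \<in> X" "y \<in> {1..n} - X" for x y
    proof -
      have "adj X (insert y (X - {x}))" using that unfolding adj_def by blast
      then show ?thesis using iso swap_rsets[OF Xr(1) that(1)] that(2) nonbases_eq[OF M] by auto
    qed
    have "X \<noteq> {1..n}" using Xs r by auto
    then obtain y0 where y0: "y0 \<in> {1..n} - X" using Xs(1) by blast
    obtain x0 where x0: "x0 \<in> X" using Xs r by fastforce
    have del: "X - {x} \<in> indeps M" if "x \<in> X" for x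
      using indep_mono[OF m(1) swap[OF that y0]] by blast
    have "Z \<in> indeps M" if Z: "Z \<subset> X" for Z
    proof -
      obtain x where "x \<in> X" "x \<notin> Z" using Z by blast
      then have "x \<in> X" "Z \<subseteq> X - {x}" using Z by auto
      then show ?thesis using del indep_mono[OF m(1)] by blast
    qed
    then have circ: "X \<in> circuits M" unfolding circuits_def using Xs(1) Xr(2) m(2) by simp
    have rX: "rank_of M X = r - 1"
    proof (rule rank_of_eqI[OF m(1) del[OF x0]])
      show "card (X - {x0}) = r - 1" using Xs x0 by simp
      fix J assume J: "J \<in> indeps M" "J \<subseteq> X"
      then have "J \<subset> X" using Xr(2) by blast
      then have "card J < card X" using Xs(3) psubset_card_mono by blast
      then show "card J \<le> r - 1" using Xs by simp
    qed auto
    have rY: "rank_of M (insert y X) = r" if "y \<in> {1..n} - X" for y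
    proof (rule rank_of_eqI[OF m(1) swap[OF x0 that]])
      show "card (insert y (X - {x0})) = r" using swap_rsets[OF Xr(1) x0, of y] that by (simp add: rsets_def)
    qed (use matroids_of_rank_card[OF M] in auto)
    have "closure M X = X"
    proof (intro equalityI subsetI)
      fix y assume y: "y \<in> closure M X"
      then have "rank_of M (insert y X) = r - 1" "y \<in> {1..n}" using rX m(2) unfolding closure_def by auto
      then show "y \<in> X" using rY[of y] r by (cases "y \<in> X") auto
    next
      fix y assume "y \<in> X"
      then show "y \<in> closure M X" using Xs(1) m(2) unfolding closure_def by (auto simp: insert_absorb)
    qed
    then have "X \<in> hyperplanes M" unfolding hyperplanes_def flats_def using rX r m(2,3) Xs(1) by simp
    then show "X \<in> W M" using circ unfolding W_def by blast
  }
qed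

lemma U_iff:
  assumes "M \<in> matroids_of_rank n r" "0 < r" "r < n"
  shows "X \<in> U M \<longleftrightarrow> X \<in> nonbases M \<and> (\<exists>Y\<in>nonbases M. adj X Y)"
  using W_iff_isolated[OF assms] unfolding U_def by blast

text \<open>A circuit has rank one below its size and a hyperplane has rank \<open>r - 1\<close>,
  which fixes the size of \<open>X\<close>.\<close>

lemma W_nonbases:
  assumes "M \<in> matroids_of_rank n r" "X \<in> W M" "0 < r"
  shows "X \<in> nonbases M"
proof -
  note m = matroids_of_rankD[OF assms(1)]
  have c: "X \<subseteq> {1..n}" "X \<notin> indeps M" "\<And>Z. Z \<subset> X \<Longrightarrow> Z \<in> indeps M"
    using assms(2) m unfolding W_def circuits_def by auto
  have f: "finite X" using c(1) finite_subset[of X "{1..n}"] by simp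
  have rX: "rank_of M X + 1 = r" using assms(2) m unfolding W_def hyperplanes_def by auto
  have "X \<noteq> {}" using c(2) matroidD(3)[OF m(1)] by auto
  then obtain x where x: "x \<in> X" by blast
  have "card (X - {x}) \<le> rank_of M X" using c(3)[of "X - {x}"] x card_le_rank_of[OF m(1)] by blast
  moreover obtain I where I: "I \<in> indeps M" "I \<subseteq> X" "card I = rank_of M X"
    using rank_of_witness[OF m(1)] by blast
  moreover have "card I < card X" using I c(2) psubset_card_mono[OF f, of I] by blast
  ultimately have "card X = r" using f x rX by simp
  then show ?thesis using nonbases_eq[OF assms(1)] c unfolding rsets_def by auto
qed

text \<open>An edge of the Johnson graph lies in two cliques: the \<open>r\<close>-subsets of
  \<open>insert y X\<close> and the \<open>r\<close>-sets above \<open>X - {x}\<close>. If both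
  contained a basis, \<open>X - {x}\<close> would be independent, and augmenting it from the basis
  inside \<open>insert y X\<close> would add \<open>x\<close> or \<open>y\<close>, making one end of
  the edge a basis.\<close>

lemma nonbasis_pair_cases:
  assumes M: "M \<in> matroids_of_rank n r" and X: "X \<in> nonbases M" "insert y (X - {x}) \<in> nonbases M"
    and xy: "x \<in> X" "y \<notin> X"
  shows "(\<forall>z\<in>insert y X. insert y X - {z} \<notin> indeps M) \<or>
         (\<forall>w. w \<notin> X - {x} \<longrightarrow> insert w (X - {x}) \<notin> indeps M)"
proof (rule ccontr)
  note m = matroids_of_rankD[OF M]
  assume "\<not> ?thesis"
  then obtain z w where z: "z \<in> insert y X" "insert y X - {z} \<in> indeps M"
    and w: "insert w (X - {x}) \<in> indeps M" by blast
  have Xi: "X \<notin> indeps M" "insert y (X - {x}) \<notin> indeps M" using X nonbases_eq[OF M] by auto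
  have f: "finite X" using X nonbases_eq[OF M] finite_rset by blast
  have i: "X - {x} \<in> indeps M" using indep_mono[OF m(1) w] by blast
  have "card (insert y X - {z}) = card X" using z(1) xy f by (simp add: card_Diff_singleton_if)
  moreover have "card (X - {x}) < card X" using f xy by (meson card_Diff1_less)
  ultimately obtain b where b: "b \<in> (insert y X - {z}) - (X - {x})" "insert b (X - {x}) \<in> indeps M"
    using augment[OF m(1) i z(2)] by auto
  then have "b = x \<or> b = y" by blast
  then show False using b(2) Xi xy(1) by (auto simp: insert_absorb)
qed

text \<open>The set is the unique circuit inside \<open>Z\<close>. Were it independent, it would
  extend within \<open>Z\<close> to an independent \<open>Z - {b}\<close>; then \<open>b\<close>
  belongs to the set by definition but is missing from the extension.\<close>

lemma fundamental_circuit_dependent: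
  assumes M: "M \<in> matroids_of_rank n r" and Z: "card Z = Suc r" "z \<in> Z" "Z - {z} \<in> indeps M"
  shows "{z \<in> Z. Z - {z} \<in> indeps M} \<notin> indeps M"
proof
  note m = matroids_of_rankD[OF M]
  let ?C = "{z \<in> Z. Z - {z} \<in> indeps M}"
  assume C: "?C \<in> indeps M"
  have f: "finite Z" using Z(1) by (metis card.infinite nat.distinct(1))
  have cz: "card (Z - {z}) = r" using Z f by simp
  obtain B where B: "B \<in> indeps M" "?C \<subseteq> B" "B \<subseteq> ?C \<union> (Z - {z})" "card B = r"
    using extend_indep[OF m(1) C Z(3)] matroids_of_rank_card[OF M C] cz by auto
  have sub: "B \<subseteq> Z" using B(3) by blast
  have "card (Z - B) = 1" using sub B(4) Z(1) f by (simp add: card_Diff_subset finite_subset)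
  then obtain b where b: "Z - B = {b}" by (meson card_1_singletonE)
  then have "B = Z - {b}" using sub by blast
  then show False using b B(1,2) by blast
qed

text \<open>Dual counterpart: the elements completing \<open>Y\<close> to a basis form the cocircuit
  complementary to the closure of \<open>Y\<close>, and augmenting \<open>Y\<close> from
  \<open>B\<close> finds one of them in \<open>B\<close>.\<close>

lemma fundamental_cocircuit_meets:
  assumes M: "M \<in> matroids_of_rank n r" and Y: "Suc (card Y) = r" "Y \<in> indeps M"
    and B: "B \<in> indeps M" "card B = r"
  shows "\<exists>w\<in>B. w \<notin> Y \<and> insert w Y \<in> indeps M"
  using augment[OF matroids_of_rankD(1)[OF M] Y(2) B(1)] Y(1) B(2) by auto

text \<open>Exchanging an element of \<open>Y\<close> outside \<open>C\<close> keeps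
  \<open>C\<close> inside the set, so \<open>Y\<close> has a neighbour that is also a
  nonbasis.\<close>

lemma U_above:
  assumes M: "M \<in> matroids_of_rank n r" and r: "0 < r" "r < n"
    and C: "C \<notin> indeps M" "C \<subset> Y" and Y: "Y \<in> rsets n r"
  shows "Y \<in> U M"
proof -
  note m = matroids_of_rankD[OF M]
  obtain x where x: "x \<in> Y" "x \<notin> C" using C(2) by blast
  have "Y \<noteq> {1..n}" using Y r unfolding rsets_def by auto
  then obtain y where y: "y \<in> {1..n}" "y \<notin> Y" using Y unfolding rsets_def by blast
  have "insert y (Y - {x}) \<in> rsets n r" using swap_rsets[OF Y x(1) y(2,1)] .
  moreover have "insert y (Y - {x}) \<notin> indeps M" "Y \<notin> indeps M"
    using C x indep_mono[OF m(1), of _ C] by blast+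
  moreover have "adj Y (insert y (Y - {x}))" using x y unfolding adj_def by blast
  ultimately show ?thesis using U_iff[OF M r] Y nonbases_eq[OF M] by blast
qed

text \<open>Dual to \<open>U_above\<close>: bringing in an element of \<open>H\<close> gives a
  neighbour that still lies in \<open>H\<close>.\<close>

lemma U_below:
  assumes M: "M \<in> matroids_of_rank n r" and r: "0 < r" "r < n"
    and H: "H \<subseteq> {1..n}" "\<And>B. B \<in> indeps M \<Longrightarrow> card B = r \<Longrightarrow> \<not> B \<subseteq> H" "Y \<subset> H"
    and Y: "Y \<in> rsets n r"
  shows "Y \<in> U M"
proof -
  obtain y where y: "y \<in> H" "y \<notin> Y" using H(3) by blast
  have "Y \<noteq> {}" using Y r unfolding rsets_def by auto
  then obtain x where x: "x \<in> Y" by blast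
  have sw: "insert y (Y - {x}) \<in> rsets n r" using swap_rsets[OF Y x y(2)] y(1) H(1) by blast
  have "Z \<notin> indeps M" if "Z \<in> rsets n r" "Z \<subseteq> H" for Z
    using H(2)[of Z] that unfolding rsets_def by blast
  then have "insert y (Y - {x}) \<notin> indeps M" "Y \<notin> indeps M" using sw Y H(3) y x by blast+
  moreover have "adj Y (insert y (Y - {x}))" using x y unfolding adj_def by blast
  ultimately show ?thesis using U_iff[OF M r] Y sw nonbases_eq[OF M] by blast
qed

text \<open>The three families serve as circuits, hyperplanes, and centres of balls in the Johnson
  graph that consist of nonbases.\<close>

definition covered_by :: "nat set set \<Rightarrow> nat set set \<Rightarrow> nat set set \<Rightarrow> nat set \<Rightarrow> bool" where
  "covered_by \<C> \<H> \<Q> Y \<longleftrightarrow>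
     (\<exists>C\<in>\<C>. C \<subseteq> Y) \<or> (\<exists>H\<in>\<H>. Y \<subseteq> H) \<or> (\<exists>X\<in>\<Q>. Y = X \<or> adj X Y)"

text \<open>If some neighbour of \<open>X\<close> is a basis, then \<open>X\<close> contains just
  one circuit \<open>C\<close> and spans a hyperplane \<open>H\<close>. Exchanging \<open>x\<close>
  for \<open>y\<close> gives another nonbasis only if \<open>x\<close> is outside \<open>C\<close>
  or \<open>y\<close> is in \<open>H\<close>, so the result contains \<open>C\<close> or lies in
  \<open>H\<close>. Otherwise the whole ball around \<open>X\<close> lies in
  \<open>U M\<close>.\<close>

lemma local_cover:
  assumes M: "M \<in> matroids_of_rank n r" and r: "0 < r" "r < n" and X: "X \<in> U M"
  shows "(\<forall>Y\<in>rsets n r. Y = X \<or> adj X Y \<longrightarrow> Y \<in> U M) \<or>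
    (\<exists>C H. C \<subseteq> {1..n} \<and> H \<subseteq> {1..n} \<and> (\<forall>Y\<in>rsets n r. C \<subseteq> Y \<or> Y \<subseteq> H \<longrightarrow> Y \<in> U M) \<and>
       (\<forall>Y\<in>U M. Y = X \<or> adj X Y \<longrightarrow> C \<subseteq> Y \<or> Y \<subseteq> H))"
proof (cases "\<forall>Y\<in>rsets n r. adj X Y \<longrightarrow> Y \<notin> indeps M")
  case True
  have "Y \<in> U M" if "Y \<in> rsets n r" "adj X Y" for Y
    using True that X adj_sym[OF that(2)] U_iff[OF M r] nonbases_eq[OF M] by blast
  then show ?thesis using X by blast
next
  case False
  note m = matroids_of_rankD[OF M]
  have Xn: "X \<in> rsets n r" "X \<notin> indeps M" using X U_iff[OF M r] nonbases_eq[OF M] by auto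
  then have Xs: "X \<subseteq> {1..n}" "card X = r" "finite X" using finite_rset[OF Xn(1)] by (simp_all add: rsets_def)
  obtain a b where ab: "a \<in> X" "b \<notin> X" "insert b (X - {a}) \<in> indeps M"
    using False unfolding adj_def by blast
  have ai: "X - {a} \<in> indeps M" using indep_mono[OF m(1) ab(3)] by blast
  have ca: "card (X - {x}) = r - 1" if "x \<in> X" for x using that Xs by simp
  \<comment> \<open>As \<open>X - {a}\<close> is independent, \<open>X\<close> has rank
    \<open>r - 1\<close>; \<open>C\<close> is its only circuit and \<open>H\<close> its
    closure.\<close>
  define C where "C = {x \<in> X. X - {x} \<in> indeps M}"
  define H where "H = {y \<in> {1..n}. \<forall>B\<in>indeps M. card B = r \<longrightarrow> \<not> B \<subseteq> insert y X}"
  have Cd: "C \<notin> indeps M"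
  proof
    assume Ci: "C \<in> indeps M"
    have "C \<noteq> X" using Ci Xn(2) by blast
    then have "card C < card X" using Xs(3) by (simp add: C_def psubset_card_mono psubsetI)
    then have "card C \<le> card (X - {a})" using ca[OF ab(1)] Xs(2) by simp
    then obtain B where B: "B \<in> indeps M" "C \<subseteq> B" "B \<subseteq> C \<union> (X - {a})" "card B = r - 1"
      using extend_indep[OF m(1) Ci ai] ca[OF ab(1)] by auto
    have sub: "B \<subseteq> X" using B(3) unfolding C_def by blast
    have "card (X - B) = 1"
      using sub B(4) Xs r by (simp add: card_Diff_subset finite_subset)
    then obtain z where z: "X - B = {z}" by (meson card_1_singletonE)
    then have "B = X - {z}" using sub by blast
    then show False using z B(1,2) unfolding C_def by blast
  qed
  have noB: "\<not> B \<subseteq> X" if "B \<in> indeps M" "card B = r" for B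
    using that Xn(2) Xs card_seteq[of X B] by auto
  have XH: "X \<subseteq> H" using Xs(1) noB unfolding H_def by (auto simp: insert_absorb)
  have Hn: "\<not> B \<subseteq> H" if B: "B \<in> indeps M" "card B = r" for B
  proof
    assume BH: "B \<subseteq> H"
    have "card (X - {a}) < card B" using ca[OF ab(1)] B(2) r by simp
    then obtain b' where b': "b' \<in> B - (X - {a})" "insert b' (X - {a}) \<in> indeps M"
      using augment[OF m(1) ai B(1)] by blast
    have "card (insert b' (X - {a})) = r" using b'(1) Xs ca[OF ab(1)] r by simp
    then have "\<not> insert b' (X - {a}) \<subseteq> insert b' X" using b' BH unfolding H_def by blast
    then show False by blast
  qed
  have "Y \<in> U M" if Y: "Y \<in> rsets n r" and CH: "C \<subseteq> Y \<or> Y \<subseteq> H" for Y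
  proof -
    have fY: "finite Y" "card Y = r" using Y finite_rset[OF Y] by (simp_all add: rsets_def)
    \<comment> \<open>\<open>U_above\<close> and \<open>U_below\<close> handle proper inclusions.
      Since \<open>C\<close> is inside \<open>X\<close> and \<open>X\<close> inside
      \<open>H\<close>, equality forces \<open>Y = X\<close> by cardinality.\<close>
    consider "C \<subset> Y" | "Y \<subset> H" | "C = Y" | "Y = H" using CH by blast
    then show ?thesis
    proof cases
      case 1
      then show ?thesis using U_above[OF M r Cd _ Y] by blast
    next
      case 2
      then show ?thesis using U_below[OF M r _ Hn _ Y] unfolding H_def by blast
    next
      case 3
      then have "Y \<subseteq> X" unfolding C_def by blast
      then have "Y = X" using card_subset_eq[OF Xs(3), of Y] fY(2) Xs(2) by simp
      then show ?thesis using X by simp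
    next
      case 4
      then have "X = Y" using card_subset_eq[OF fY(1), of X] fY(2) Xs(2) XH by simp
      then show ?thesis using X by simp
    qed
  qed
  moreover have "C \<subseteq> Y \<or> Y \<subseteq> H" if Y: "Y \<in> U M" "Y = X \<or> adj X Y" for Y
  proof (cases "Y = X")
    case True
    then show ?thesis using XH by simp
  next
    case False
    then obtain x y where xy: "x \<in> X" "y \<notin> X" "Y = insert y (X - {x})"
      using Y(2) unfolding adj_def by blast
    have Yn: "Y \<in> rsets n r" "Y \<notin> indeps M" using Y(1) U_iff[OF M r] nonbases_eq[OF M] by auto
    show ?thesis
    proof (cases "x \<in> C")
      case False
      then show ?thesis using xy unfolding C_def by blast
    next
      case True
      then have xi: "X - {x} \<in> indeps M" unfolding C_def by blast
      have "y \<in> H"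
      proof (rule ccontr)
        assume "y \<notin> H"
        then obtain B where B: "B \<in> indeps M" "card B = r" "B \<subseteq> insert y X"
          using Yn(1) xy unfolding H_def rsets_def by blast
        have "card (X - {x}) < card B" using ca[OF xy(1)] B(2) r by simp
        then obtain b' where b': "b' \<in> B - (X - {x})" "insert b' (X - {x}) \<in> indeps M"
          using augment[OF m(1) xi B(1)] by blast
        then have "b' = x \<or> b' = y" using B(3) by blast
        then show False using b'(2) Xn(2) Yn(2) xy by (auto simp: insert_absorb)
      qed
      then show ?thesis using XH xy by blast
    qed
  qed
  ultimately have "\<exists>C H. C \<subseteq> {1..n} \<and> H \<subseteq> {1..n} \<and> (\<forall>Y\<in>rsets n r. C \<subseteq> Y \<or> Y \<subseteq> H \<longrightarrow> Y \<in> U M) \<and>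
       (\<forall>Y\<in>U M. Y = X \<or> adj X Y \<longrightarrow> C \<subseteq> Y \<or> Y \<subseteq> H)"
    using Xs(1) by (intro exI[of _ C] exI[of _ H]) (auto simp: C_def H_def)
  then show ?thesis ..
qed

section \<open>Domination in Johnson graphs\<close>

definition closed_nbhd :: "('a \<Rightarrow> 'a \<Rightarrow> bool) \<Rightarrow> 'a set \<Rightarrow> 'a set" where
  "closed_nbhd E S = S \<union> {u. \<exists>v\<in>S. E v u}"

lemma closed_nbhd_insert: "closed_nbhd E (insert v S) = insert v {u. E v u} \<union> closed_nbhd E S"
  unfolding closed_nbhd_def by blast

text \<open>While more than \<open>a\<close> vertices remain, some vertex removes at least the
  fraction \<open>c\<close> of them; the \<open>max\<close> accounts for stopping early.\<close>

lemma greedy_dominate: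
  fixes a c :: real
  assumes fin: "finite R" and c: "0 \<le> c" "c \<le> 1" and a: "0 \<le> a"
    and deg: "\<And>R'. R' \<subseteq> R \<Longrightarrow> real (card R') > a \<Longrightarrow>
      \<exists>v\<in>R'. real (card {u\<in>R'. E v u}) \<ge> c * real (card R')"
  shows "\<exists>S\<subseteq>R. card S \<le> t \<and>
    real (card (R - closed_nbhd E S)) \<le> max a ((1 - c) ^ t * real (card R))"
proof (induction t)
  case 0
  show ?case by (rule exI[of _ "{}"]) (simp add: closed_nbhd_def)
next
  case (Suc t)
  then obtain S where S: "S \<subseteq> R" "card S \<le> t"
    "real (card (R - closed_nbhd E S)) \<le> max a ((1 - c) ^ t * real (card R))" by blast
  let ?R = "R - closed_nbhd E S"
  have fS: "finite S" using S(1) fin finite_subset by blast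
  show ?case
  proof (cases "real (card ?R) > a")
    case False
    then show ?thesis using S by (intro exI[of _ S]) auto
  next
    case True
    then obtain v where v: "v \<in> ?R" "real (card {u\<in>?R. E v u}) \<ge> c * real (card ?R)"
      using deg[of ?R] by blast
    have le: "real (card ?R) \<le> (1 - c) ^ t * real (card R)" using S(3) True by linarith
    have sub: "R - closed_nbhd E (insert v S) \<subseteq> ?R - {u\<in>?R. E v u}"
      unfolding closed_nbhd_insert by blast
    have "card (R - closed_nbhd E (insert v S)) \<le> card (?R - {u\<in>?R. E v u})"
      by (rule card_mono[OF _ sub]) (use fin in simp)
    also have "real (card (?R - {u\<in>?R. E v u})) = real (card ?R) - real (card {u\<in>?R. E v u})"
      using fin by (subst card_Diff_subset) (auto intro!: of_nat_diff card_mono)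
    also have "\<dots> \<le> (1 - c) * real (card ?R)" using v(2) by (simp add: algebra_simps)
    also have "\<dots> \<le> (1 - c) * ((1 - c) ^ t * real (card R))"
      using le c by (intro mult_left_mono) auto
    finally have "real (card (R - closed_nbhd E (insert v S))) \<le> (1 - c) ^ Suc t * real (card R)"
      by simp
    moreover have "card (insert v S) \<le> Suc t" using S(2) fS by (simp add: card_insert_if)
    ultimately show ?thesis using S(1) v(1) by (intro exI[of _ "insert v S"]) auto
  qed
qed

text \<open>Each chosen vertex removes at least \<open>q\<close> vertices not removed before, which
  bounds \<open>card S * q\<close>; the process stops once all remaining degrees are below
  \<open>q\<close>.\<close>

lemma greedy_low_degree:
  assumes "finite R"
  shows "\<exists>S\<subseteq>R. card S * q \<le> card R \<and>
    (\<forall>v\<in>R - closed_nbhd E S. card {u\<in>R - closed_nbhd E S. E v u} < q)"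
  using assms
proof (induction "card R" arbitrary: R rule: less_induct)
  case less
  show ?case
  proof (cases "\<forall>v\<in>R. card {u\<in>R. E v u} < q")
    case True
    then show ?thesis by (intro exI[of _ "{}"]) (simp add: closed_nbhd_def)
  next
    case False
    then obtain v where v: "v \<in> R" "q \<le> card {u\<in>R. E v u}" by force
    define R' where "R' = R - closed_nbhd E {v}"
    have "R' \<subset> R" unfolding R'_def closed_nbhd_def using v(1) by blast
    then have "card R' < card R" "finite R'" using less.prems psubset_card_mono finite_subset by blast+
    then obtain S where S: "S \<subseteq> R'" "card S * q \<le> card R'"
      "\<forall>v\<in>R' - closed_nbhd E S. card {u\<in>R' - closed_nbhd E S. E v u} < q"
      using less.hyps by meson
    have eq: "R' - closed_nbhd E S = R - closed_nbhd E (insert v S)"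
      unfolding R'_def closed_nbhd_def by blast
    have fS: "finite S" using S(1) \<open>finite R'\<close> finite_subset by blast
    have "R' \<subseteq> R - {u\<in>R. E v u}" unfolding R'_def closed_nbhd_def by blast
    then have "card R' \<le> card (R - {u\<in>R. E v u})" using less.prems by (intro card_mono) auto
    also have "\<dots> = card R - card {u\<in>R. E v u}" using less.prems by (intro card_Diff_subset) auto
    finally have "card R' + card {u\<in>R. E v u} \<le> card R"
      using card_mono[of R "{u\<in>R. E v u}"] less.prems by auto
    then have "card S * q + q \<le> card R" using S(2) v(2) by linarith
    moreover have "card (insert v S) * q \<le> card S * q + q" using fS by (simp add: card_insert_if)
    ultimately have "card (insert v S) * q \<le> card R" by linarith
    then show ?thesis using S v(1) \<open>R' \<subset> R\<close> unfolding eq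
      by (intro exI[of _ "insert v S"]) auto
  qed
qed

text \<open>Count pairs through the \<open>(r - 1)\<close>-sets they share; the Cauchy-Schwarz step is the
  inequality \<open>(d - m)\<^sup>2 \<ge> 0\<close> with \<open>m\<close> the mean number of members of \<open>R\<close> above such a set.\<close>

lemma johnson_dense_vertex:
  assumes R: "R \<subseteq> rsets n r" "R \<noteq> {}" and r: "0 < r" "r \<le> n"
  shows "\<exists>v\<in>R. real (card {u\<in>R. adj v u}) \<ge>
    real r * (real n - real r + 1) * real (card R) / real (n choose r) - real r"
proof (rule ccontr)
  let ?D = "real r * (real n - real r + 1) * real (card R) / real (n choose r) - real r"
  assume "\<not> ?thesis"
  then have less: "\<And>v. v \<in> R \<Longrightarrow> real (card {u\<in>R. adj v u}) < ?D" by force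
  have finR: "finite R" using R(1) rsets_finite finite_subset by blast
  let ?P = "rsets n (r - 1)"
  define d where "d Y = card {X\<in>R. Y \<subseteq> X}" for Y
  have cX: "finite X" "card X = r" "X \<subseteq> {1..n}" if "X \<in> R" for X
    using that R(1) finite_rset[of X n r] by (auto simp: rsets_def)
  have below: "{Y \<in> ?P. Y \<subseteq> X} = (\<lambda>x. X - {x}) ` X" if "X \<in> R" for X
  proof (intro equalityI subsetI)
    fix Y assume "Y \<in> {Y \<in> ?P. Y \<subseteq> X}"
    then have Y: "Y \<subseteq> X" "card Y = r - 1" by (auto simp: rsets_def)
    then have "card (X - Y) = 1" using cX[OF that] r by (simp add: card_Diff_subset finite_subset)
    then obtain x where "X - Y = {x}" by (meson card_1_singletonE)
    then show "Y \<in> (\<lambda>x. X - {x}) ` X" using Y(1) by blast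
  qed (use cX[OF that] in \<open>auto simp: rsets_def\<close>)
  have inj: "inj_on (\<lambda>x. X - {x}) X" for X :: "nat set" by (rule inj_onI) blast
  have sum1: "(\<Sum>Y\<in>?P. real (d Y)) = real r * real (card R)"
  proof -
    have "(\<Sum>Y\<in>?P. d Y) = (\<Sum>Y\<in>?P. \<Sum>X\<in>R. if Y \<subseteq> X then 1 else 0)"
      unfolding d_def using finR by (intro sum.cong) (auto simp: sum.If_cases Int_def)
    also have "\<dots> = (\<Sum>X\<in>R. \<Sum>Y\<in>?P. if Y \<subseteq> X then 1 else 0)" by (rule sum.swap)
    also have "\<dots> = (\<Sum>X\<in>R. card {Y \<in> ?P. Y \<subseteq> X})"
      using rsets_finite by (intro sum.cong) (auto simp: sum.If_cases Int_def)
    also have "\<dots> = (\<Sum>X\<in>R. r)" using below cX inj by (intro sum.cong) (auto simp: card_image)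
    finally have eq: "(\<Sum>Y\<in>?P. d Y) = card R * r" by simp
    have "(\<Sum>Y\<in>?P. real (d Y)) = real (\<Sum>Y\<in>?P. d Y)" by simp
    then show ?thesis unfolding eq by simp
  qed
  have sum2: "(\<Sum>Y\<in>?P. real (d Y) * real (d Y)) =
      (\<Sum>X\<in>R. real (card {Z\<in>R. adj X Z}) + real r)"
  proof -
    have "(\<Sum>Y\<in>?P. d Y * d Y) = (\<Sum>Y\<in>?P. \<Sum>X\<in>R. if Y \<subseteq> X then d Y else 0)"
      unfolding d_def using finR by (intro sum.cong) (auto simp: sum.If_cases Int_def)
    also have "\<dots> = (\<Sum>X\<in>R. \<Sum>Y\<in>?P. if Y \<subseteq> X then d Y else 0)" by (rule sum.swap)
    also have "\<dots> = (\<Sum>X\<in>R. \<Sum>Y\<in>{Y \<in> ?P. Y \<subseteq> X}. d Y)"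
      by (simp only: sum.inter_filter[OF rsets_finite])
    also have "\<dots> = (\<Sum>X\<in>R. card {Z\<in>R. adj X Z} + r)"
    proof (rule sum.cong[OF refl])
      fix X assume X: "X \<in> R"
      have "(\<Sum>Y\<in>{Y \<in> ?P. Y \<subseteq> X}. d Y) = (\<Sum>x\<in>X. d (X - {x}))"
        unfolding below[OF X] using inj by (simp add: sum.reindex)
      also have "\<dots> = (\<Sum>x\<in>X. card {Z\<in>R. Z \<noteq> X \<and> X - {x} \<subseteq> Z} + 1)"
      proof (rule sum.cong[OF refl])
        fix x
        have "{Z\<in>R. X - {x} \<subseteq> Z} = insert X {Z\<in>R. Z \<noteq> X \<and> X - {x} \<subseteq> Z}" using X by blast
        then show "d (X - {x}) = card {Z\<in>R. Z \<noteq> X \<and> X - {x} \<subseteq> Z} + 1"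
          unfolding d_def using finR by simp
      qed
      also have "\<dots> = (\<Sum>x\<in>X. card {Z\<in>R. Z \<noteq> X \<and> X - {x} \<subseteq> Z}) + r"
        using cX[OF X] by (simp add: sum.distrib sum_Suc)
      \<comment> \<open>Two distinct sets \<open>X - {i}\<close> and \<open>X - {j}\<close> have
        union \<open>X\<close>, so an \<open>r\<close>-set other than \<open>X\<close> lies above at
        most one of them.\<close>
      also have "(\<Sum>x\<in>X. card {Z\<in>R. Z \<noteq> X \<and> X - {x} \<subseteq> Z}) =
          card (\<Union>x\<in>X. {Z\<in>R. Z \<noteq> X \<and> X - {x} \<subseteq> Z})"
      proof (rule card_UN_disjoint[symmetric])
        show "\<forall>i\<in>X. \<forall>j\<in>X. i \<noteq> j \<longrightarrow>
          {Z\<in>R. Z \<noteq> X \<and> X - {i} \<subseteq> Z} \<inter> {Z\<in>R. Z \<noteq> X \<and> X - {j} \<subseteq> Z} = {}"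
        proof (intro ballI impI)
          fix i j assume ij: "i \<in> X" "j \<in> X" "i \<noteq> j"
          have "Z = X" if "Z \<in> R" "X - {i} \<subseteq> Z" "X - {j} \<subseteq> Z" for Z
          proof -
            have "X \<subseteq> Z" using that(2,3) ij by blast
            then show ?thesis using card_subset_eq[of Z X] cX[OF X] cX[OF that(1)] by simp
          qed
          then show "{Z\<in>R. Z \<noteq> X \<and> X - {i} \<subseteq> Z} \<inter> {Z\<in>R. Z \<noteq> X \<and> X - {j} \<subseteq> Z} = {}" by blast
        qed
      qed (use cX[OF X] finR in auto)
      also have "(\<Union>x\<in>X. {Z\<in>R. Z \<noteq> X \<and> X - {x} \<subseteq> Z}) = {Z\<in>R. adj X Z}"
      proof (intro equalityI subsetI)
        fix Z assume "Z \<in> (\<Union>x\<in>X. {Z\<in>R. Z \<noteq> X \<and> X - {x} \<subseteq> Z})"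
        then obtain x where x: "x \<in> X" "Z \<in> R" "Z \<noteq> X" "X - {x} \<subseteq> Z" by blast
        have "card (Z - (X - {x})) = 1"
          using x cX[OF X] cX[OF x(2)] r by (simp add: card_Diff_subset)
        then obtain y where y: "Z - (X - {x}) = {y}" by (meson card_1_singletonE)
        then have Z: "Z = insert y (X - {x})" using x(4) by blast
        have "y \<notin> X" using Z x(1,3) y by (cases "y = x") auto
        then have "adj X Z" using Z x(1) unfolding adj_def by blast
        then show "Z \<in> {Z\<in>R. adj X Z}" using x(2) by blast
      next
        fix Z assume Z: "Z \<in> {Z\<in>R. adj X Z}"
        then have "Z \<noteq> X" using adj_irrefl by blast
        then show "Z \<in> (\<Union>x\<in>X. {Z\<in>R. Z \<noteq> X \<and> X - {x} \<subseteq> Z})" using Z unfolding adj_def by blast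
      qed
      finally show "(\<Sum>Y\<in>{Y \<in> ?P. Y \<subseteq> X}. d Y) = card {Z\<in>R. adj X Z} + r" .
    qed
    finally have "real (\<Sum>Y\<in>?P. d Y * d Y) = real (\<Sum>X\<in>R. card {Z\<in>R. adj X Z} + r)" by simp
    then show ?thesis by simp
  qed
  have rn: "real r \<le> real n" "0 < real r" using r by auto
  have bin: "real (n choose (r - 1)) * (real n - real r + 1) = real (n choose r) * real r"
  proof -
    have "Suc (r - 1) * (n choose Suc (r - 1)) = (n choose (r - 1)) * (n - (r - 1))"
      using binomial_absorption[of "r - 1" n] binomial_absorb_comp[of n "r - 1"] by (simp add: mult.commute)
    then have "r * (n choose r) = (n choose (r - 1)) * (n - (r - 1))" using r by simp
    then have "real r * real (n choose r) = real (n choose (r - 1)) * real (n - (r - 1))"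
      by (simp only: of_nat_mult[symmetric])
    then show ?thesis using r by (simp add: algebra_simps)
  qed
  have cN: "0 < real (n choose r)" using r by simp
  define m where "m = (real n - real r + 1) * real (card R) / real (n choose r)"
  have "0 \<le> (\<Sum>Y\<in>?P. (real (d Y) - m)\<^sup>2)" by (rule sum_nonneg) simp
  also have "\<dots> = (\<Sum>Y\<in>?P. real (d Y) * real (d Y)) - 2 * m * (\<Sum>Y\<in>?P. real (d Y))
      + real (card ?P) * m\<^sup>2"
    by (simp add: power2_eq_square algebra_simps sum.distrib sum_subtractf sum_distrib_left)
  \<comment> \<open>By \<open>bin\<close>, \<open>card ?P * m\<close> equals
    \<open>r * card R\<close>, the total number of incidences.\<close>
  also have "real (card ?P) * m\<^sup>2 = m * (real r * real (card R))"
  proof -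
    have "real (card ?P) * m\<^sup>2 =
        (real (n choose (r - 1)) * (real n - real r + 1)) * (real (card R) * m / real (n choose r))"
      unfolding card_rsets power2_eq_square by (simp add: m_def)
    also have "\<dots> = m * (real r * real (card R))" unfolding bin using cN by simp
    finally show ?thesis .
  qed
  finally have "m * (real r * real (card R)) \<le> (\<Sum>X\<in>R. real (card {Z\<in>R. adj X Z}) + real r)"
    unfolding sum1 sum2 by simp
  also have "\<dots> < (\<Sum>X\<in>R. ?D + real r)"
    by (intro sum_strict_mono finR R(2) add_strict_right_mono less)
  also have "\<dots> = m * (real r * real (card R))" unfolding m_def by simp
  finally show False by simp
qed

section \<open>Compressed descriptions\<close>

text \<open>The local descriptions are pooled into three unordered families. Circuits need not be
  paired with hyperplanes, nor attached to their vertex, because every member certifies membership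
  in \<open>U M\<close> by itself.\<close>

lemma cover_families:
  assumes M: "M \<in> matroids_of_rank n r" and r: "0 < r" "r < n" and S: "S \<subseteq> U M"
  shows "\<exists>\<C> \<H> \<Q>. \<C> \<subseteq> Pow {1..n} \<and> \<H> \<subseteq> Pow {1..n} \<and> \<Q> \<subseteq> Pow {1..n} \<and>
    card \<C> \<le> card S \<and> card \<H> \<le> card S \<and> card \<Q> \<le> card S \<and>
    (\<forall>Y\<in>rsets n r. covered_by \<C> \<H> \<Q> Y \<longrightarrow> Y \<in> U M) \<and>
    (\<forall>Y\<in>U M \<inter> closed_nbhd adj S. covered_by \<C> \<H> \<Q> Y)"
proof -
  let ?full = "\<lambda>X. \<forall>Y\<in>rsets n r. Y = X \<or> adj X Y \<longrightarrow> Y \<in> U M"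
  let ?loc = "\<lambda>X C H. C \<subseteq> {1..n} \<and> H \<subseteq> {1..n} \<and> (\<forall>Y\<in>rsets n r. C \<subseteq> Y \<or> Y \<subseteq> H \<longrightarrow> Y \<in> U M) \<and>
       (\<forall>Y\<in>U M. Y = X \<or> adj X Y \<longrightarrow> C \<subseteq> Y \<or> Y \<subseteq> H)"
  define Q where "Q = {X\<in>S. ?full X}"
  have "\<forall>X\<in>S - Q. \<exists>C H. ?loc X C H"
    using local_cover[OF M r] S unfolding Q_def by blast
  then obtain c h where ch: "\<And>X. X \<in> S - Q \<Longrightarrow> ?loc X (c X) (h X)" by metis
  have Ur: "U M \<subseteq> rsets n r" using U_iff[OF M r] nonbases_eq[OF M] by blast
  have fS: "finite S" using finite_subset[OF subset_trans[OF S Ur] rsets_finite] .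
  have le: "card (S - Q) \<le> card S" "card Q \<le> card S"
    using fS by (auto intro!: card_mono simp: Q_def)
  let ?C = "c ` (S - Q)" and ?H = "h ` (S - Q)"
  have ch1: "c X \<subseteq> {1..n} \<and> h X \<subseteq> {1..n}" if "X \<in> S - Q" for X
    using ch[OF that] by (elim conjE, intro conjI)
  have ch2: "\<forall>Y\<in>rsets n r. c X \<subseteq> Y \<or> Y \<subseteq> h X \<longrightarrow> Y \<in> U M" if "X \<in> S - Q" for X
    using ch[OF that] by (elim conjE)
  have ch3: "\<forall>Y\<in>U M. Y = X \<or> adj X Y \<longrightarrow> c X \<subseteq> Y \<or> Y \<subseteq> h X" if "X \<in> S - Q" for X
    using ch[OF that] by (elim conjE)
  have 1: "?C \<subseteq> Pow {1..n}" "?H \<subseteq> Pow {1..n}" by (intro image_subsetI; simp only: Pow_iff ch1)+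
  have QS: "Q \<subseteq> S" by (simp add: Q_def)
  have Qf: "\<forall>X\<in>Q. ?full X" by (simp add: Q_def)
  have 2: "Q \<subseteq> Pow {1..n}" using QS S Ur by (auto simp: rsets_def subset_iff)
  have 3: "card ?C \<le> card S" "card ?H \<le> card S"
    using le_trans[OF card_image_le[OF finite_Diff[OF fS]] le(1)] by auto
  have 4: "Y \<in> U M" if "Y \<in> rsets n r" "covered_by ?C ?H Q Y" for Y
    using that(2) ch2 Qf that(1) unfolding covered_by_def by blast
  have 5: "covered_by ?C ?H Q Y" if Y: "Y \<in> U M" "Y \<in> closed_nbhd adj S" for Y
  proof -
    obtain X where X: "X \<in> S" "Y = X \<or> adj X Y" using Y(2) unfolding closed_nbhd_def by blast
    show ?thesis
    proof (cases "X \<in> Q")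
      case True
      then show ?thesis using X(2) unfolding covered_by_def by blast
    next
      case False
      then have XS: "X \<in> S - Q" using X(1) by simp
      have "c X \<subseteq> Y \<or> Y \<subseteq> h X" using ch3[OF XS, rule_format, OF Y(1) X(2)] .
      then show ?thesis using XS unfolding covered_by_def by blast
    qed
  qed
  show ?thesis
  proof (rule exI[of _ ?C], rule exI[of _ ?H], rule exI[of _ Q], intro conjI)
    show "\<forall>Y\<in>rsets n r. covered_by ?C ?H Q Y \<longrightarrow> Y \<in> U M" by (intro ballI impI 4)
    show "\<forall>Y\<in>U M \<inter> closed_nbhd adj S. covered_by ?C ?H Q Y" by (intro ballI 5) auto
  qed (fact 1 2 3 le(2))+
qed

section \<open>Data of a matroid and propagation along the remainder\<close>

locale compression =
  fixes n r q t :: nat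
  assumes q: "1 \<le> q" "q < r" "r + q < n"
    and dominated: "\<And>M. M \<in> matroids_of_rank n r \<Longrightarrow> \<exists>S\<subseteq>U M. card S \<le> t \<and>
      (\<forall>v\<in>U M - closed_nbhd adj S. card {u\<in>U M - closed_nbhd adj S. adj v u} \<le> q)"
begin

lemma r: "0 < r" "r < n"
  using q by auto

definition covering :: "nat set_system \<Rightarrow> nat set set \<times> nat set set \<times> nat set set \<Rightarrow> bool" where
  "covering M = (\<lambda>(\<C>, \<H>, \<Q>). \<C> \<subseteq> Pow {1..n} \<and> \<H> \<subseteq> Pow {1..n} \<and> \<Q> \<subseteq> Pow {1..n} \<and>
    card \<C> \<le> t \<and> card \<H> \<le> t \<and> card \<Q> \<le> t \<and>
    (\<forall>Y\<in>rsets n r. covered_by \<C> \<H> \<Q> Y \<longrightarrow> Y \<in> U M) \<and>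
    (\<forall>v\<in>{v\<in>U M. \<not> covered_by \<C> \<H> \<Q> v}. card {u\<in>U M. \<not> covered_by \<C> \<H> \<Q> u \<and> adj v u} \<le> q))"

lemma U_subset_rsets: "M \<in> matroids_of_rank n r \<Longrightarrow> U M \<subseteq> rsets n r"
  using U_iff[of M n r, OF _ r] nonbases_eq[of M n r] by auto

lemma finite_U: "M \<in> matroids_of_rank n r \<Longrightarrow> finite (U M)"
  using finite_subset[OF U_subset_rsets rsets_finite] .

lemma covering_exists:
  assumes M: "M \<in> matroids_of_rank n r"
  shows "\<exists>c. covering M c"
proof -
  obtain S where S: "S \<subseteq> U M" "card S \<le> t"
    "\<forall>v\<in>U M - closed_nbhd adj S. card {u\<in>U M - closed_nbhd adj S. adj v u} \<le> q"
    using dominated[OF M] by blast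
  obtain \<C> \<H> \<Q> where c: "\<C> \<subseteq> Pow {1..n}" "\<H> \<subseteq> Pow {1..n}" "\<Q> \<subseteq> Pow {1..n}"
    "card \<C> \<le> card S" "card \<H> \<le> card S" "card \<Q> \<le> card S"
    "\<forall>Y\<in>rsets n r. covered_by \<C> \<H> \<Q> Y \<longrightarrow> Y \<in> U M"
    "\<forall>Y\<in>U M \<inter> closed_nbhd adj S. covered_by \<C> \<H> \<Q> Y"
    using cover_families[OF M r S(1)] by - (elim exE conjE, rule that; assumption)
  have "card {u\<in>U M. \<not> covered_by \<C> \<H> \<Q> u \<and> adj v u} \<le> q"
    if v: "v \<in> U M" "\<not> covered_by \<C> \<H> \<Q> v" for v
  proof -
    have "{u\<in>U M. \<not> covered_by \<C> \<H> \<Q> u \<and> adj v u} \<subseteq> {u\<in>U M - closed_nbhd adj S. adj v u}"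
      using c(8) by blast
    then have "card {u\<in>U M. \<not> covered_by \<C> \<H> \<Q> u \<and> adj v u} \<le> card {u\<in>U M - closed_nbhd adj S. adj v u}"
      using finite_U[OF M] by (intro card_mono) auto
    also have "\<dots> \<le> q"
    proof -
      have "v \<in> U M - closed_nbhd adj S" using v c(8) by blast
      then show ?thesis by (rule S(3)[rule_format])
    qed
    finally show ?thesis .
  qed
  then have "covering M (\<C>, \<H>, \<Q>)"
    unfolding covering_def using c(1-3,7) c(4-6)[THEN le_trans, OF S(2)] by simp
  then show ?thesis ..
qed

text \<open>The choice is arbitrary; what counts is that matroids with the same triple are all
  covered by it.\<close>

definition cover :: "nat set_system \<Rightarrow> nat set set \<times> nat set set \<times> nat set set" where
  "cover M = (SOME c. covering M c)"

lemma covering_cover: "M \<in> matroids_of_rank n r \<Longrightarrow> covering M (cover M)"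
  unfolding cover_def using someI_ex[OF covering_exists] .

definition small_dependent :: "nat set_system \<Rightarrow> nat set set" where
  "small_dependent M = {A. A \<subseteq> {1..n} \<and> card A \<le> q \<and> A \<notin> indeps M}"

text \<open>The dependent sets of size at most \<open>q\<close> of the dual matroid: a set meets
  every basis iff no complement of a basis contains it.\<close>

definition small_codependent :: "nat set_system \<Rightarrow> nat set set" where
  "small_codependent M = {A. A \<subseteq> {1..n} \<and> card A \<le> q \<and> (\<forall>B\<in>indeps M. card B = r \<longrightarrow> A \<inter> B \<noteq> {})}"

definition data :: "nat set_system \<Rightarrow>
    (nat set set \<times> nat set set \<times> nat set set) \<times> nat set set \<times> nat set set" where
  "data M = (cover M, small_dependent M, small_codependent M)"

text \<open>Everything that the data alone certify to lie in \<open>U\<close>. The intersection over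
  all matroids with equal data makes \<open>forced\<close> a function of the data without naming the
  individual certificates.\<close>

definition forced :: "nat set_system \<Rightarrow> nat set set" where
  "forced M = \<Inter> {U M' | M'. M' \<in> matroids_of_rank n r \<and> data M' = data M}"

definition rest :: "nat set_system \<Rightarrow> nat set set" where
  "rest M = nonbases M - forced M"

lemma forced_subset_U:
  "M \<in> matroids_of_rank n r \<Longrightarrow> M' \<in> matroids_of_rank n r \<Longrightarrow> data M' = data M \<Longrightarrow> forced M \<subseteq> U M'"
  unfolding forced_def by blast

lemma forcedI:
  "(\<And>M'. M' \<in> matroids_of_rank n r \<Longrightarrow> data M' = data M \<Longrightarrow> X \<in> U M') \<Longrightarrow> X \<in> forced M"
  unfolding forced_def by blast

lemma rest_subset: "M \<in> matroids_of_rank n r \<Longrightarrow> rest M \<subseteq> rsets n r"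
  unfolding rest_def using nonbases_eq[of M n r] by auto

lemma finite_rest: "M \<in> matroids_of_rank n r \<Longrightarrow> finite (rest M)"
  using finite_subset[OF rest_subset rsets_finite] .

lemma U_subset_nonbases: "M \<in> matroids_of_rank n r \<Longrightarrow> U M \<subseteq> nonbases M"
  unfolding U_def by blast

lemma adj_nonbases_U:
  "M \<in> matroids_of_rank n r \<Longrightarrow> X \<in> nonbases M \<Longrightarrow> Y \<in> nonbases M \<Longrightarrow> adj X Y \<Longrightarrow> X \<in> U M \<and> Y \<in> U M"
  using U_iff[of M n r, OF _ r] adj_sym[of X Y] by auto

text \<open>Covered sets are forced, because every matroid with the same data has the same covering
  triple. So \<open>rest M\<close> is uncovered, and \<open>covering\<close> bounds its degrees
  inside \<open>U M\<close>; a nonbasis outside \<open>U M\<close> has no nonbasis neighbour at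
  all.\<close>

lemma rest_degree:
  assumes M: "M \<in> matroids_of_rank n r" and X: "X \<in> rest M"
  shows "card {Y\<in>rest M. adj X Y} \<le> q"
proof -
  obtain \<C> \<H> \<Q> where c: "cover M = (\<C>, \<H>, \<Q>)" by (cases "cover M") auto
  have forced: "Y \<in> forced M" if "Y \<in> rsets n r" "covered_by \<C> \<H> \<Q> Y" for Y
  proof (rule forcedI)
    fix M' assume M': "M' \<in> matroids_of_rank n r" "data M' = data M"
    then have "covering M' (\<C>, \<H>, \<Q>)" using covering_cover[OF M'(1)] c unfolding data_def by simp
    then show "Y \<in> U M'" using that unfolding covering_def by simp
  qed
  have unc: "\<not> covered_by \<C> \<H> \<Q> Y" if "Y \<in> rest M" for Y
    using forced that rest_subset[OF M] unfolding rest_def by blast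
  have U: "X \<in> U M \<and> Y \<in> U M" if "Y \<in> rest M" "adj X Y" for Y
    using adj_nonbases_U[OF M _ _ that(2)] X that unfolding rest_def by blast
  show ?thesis
  proof (cases "X \<in> U M")
    case False
    then have "{Y\<in>rest M. adj X Y} = {}" using U by blast
    then show ?thesis by (simp only: card.empty)
  next
    case True
    have "{Y\<in>rest M. adj X Y} \<subseteq> {u\<in>U M. \<not> covered_by \<C> \<H> \<Q> u \<and> adj X u}" using U unc by blast
    then have "card {Y\<in>rest M. adj X Y} \<le> card {u\<in>U M. \<not> covered_by \<C> \<H> \<Q> u \<and> adj X u}"
      using finite_U[OF M] by (intro card_mono) auto
    also have "\<dots> \<le> q" using covering_cover[OF M] True unc[OF X] unfolding c covering_def by simp
    finally show ?thesis .
  qed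
qed

text \<open>\<open>A\<close> is dependent in every matroid with the same data, and
  \<open>card A \<le> q < r\<close> makes its inclusion in \<open>X\<close> proper, as
  \<open>U_above\<close> requires.\<close>

lemma small_dependent_forced:
  assumes M: "M \<in> matroids_of_rank n r" and A: "A \<in> small_dependent M" "A \<subseteq> X" "X \<in> rsets n r"
  shows "X \<in> forced M"
proof (rule forcedI)
  fix M' assume M': "M' \<in> matroids_of_rank n r" "data M' = data M"
  then have "A \<notin> indeps M'" "card A \<le> q" using A(1) unfolding data_def small_dependent_def by blast+
  moreover have "A \<noteq> X" using A q calculation unfolding rsets_def by auto
  ultimately show "X \<in> U M'" using U_above[OF M'(1) r, of A X] A by blast
qed

text \<open>Dual to the preceding lemma: the complement of \<open>A\<close> contains no basis, and
  \<open>r + q < n\<close> makes the inclusion of \<open>X\<close> in it proper.\<close>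

lemma small_codependent_forced:
  assumes M: "M \<in> matroids_of_rank n r" and A: "A \<in> small_codependent M" "A \<inter> X = {}" "X \<in> rsets n r"
  shows "X \<in> forced M"
proof (rule forcedI)
  fix M' assume M': "M' \<in> matroids_of_rank n r" "data M' = data M"
  then have A': "\<And>B. B \<in> indeps M' \<Longrightarrow> card B = r \<Longrightarrow> A \<inter> B \<noteq> {}" "card A \<le> q" "A \<subseteq> {1..n}"
    using A(1) unfolding data_def small_codependent_def by blast+
  have "card ({1..n} - A) = n - card A"
    using A'(3) by (simp add: card_Diff_subset finite_subset)
  then have "X \<noteq> {1..n} - A" using A(3) A'(2) q unfolding rsets_def by auto
  moreover have "X \<subseteq> {1..n} - A" using A unfolding rsets_def by blast
  ultimately show "X \<in> U M'" using U_below[OF M'(1) r, of "{1..n} - A" X] A'(1) A(3) by blast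
qed

text \<open>Suppose \<open>Z\<close> is a basis of \<open>M'\<close>, and take the clique of
  nonbases of \<open>M\<close> through the edge. The fundamental circuit (or cocircuit) in
  \<open>M'\<close> lists members of this clique that are bases of \<open>M'\<close>; these are
  unforced neighbours of \<open>X\<close>, so there are at most \<open>q\<close>. Such a small
  (co)circuit is recorded in the common data and forces \<open>X\<close>, a contradiction.\<close>

lemma propagate:
  assumes M: "M \<in> matroids_of_rank n r" and M': "M' \<in> matroids_of_rank n r" and D: "data M' = data M"
    and X: "X \<in> rest M" "X \<in> nonbases M'" and Z: "Z \<in> nonbases M" "adj X Z"
  shows "Z \<in> nonbases M'"
proof (rule ccontr)
  assume Zn: "Z \<notin> nonbases M'"
  note m' = matroids_of_rankD[OF M']
  obtain x y where xy: "x \<in> X" "y \<notin> X" "Z = insert y (X - {x})" using Z(2) unfolding adj_def by blast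
  have Xn: "X \<in> nonbases M" "X \<notin> forced M" using X(1) unfolding rest_def by auto
  have Xr: "X \<in> rsets n r" using X(1) rest_subset[OF M] by blast
  then have Xs: "X \<subseteq> {1..n}" "card X = r" "finite X" using finite_rset[OF Xr] by (simp_all add: rsets_def)
  have Zr: "Z \<in> rsets n r" "Z \<notin> indeps M" using Z(1) nonbases_eq[OF M] by auto
  then have Zi: "Z \<in> indeps M'" using Zn nonbases_eq[OF M'] by blast
  have Xi': "X \<notin> indeps M'" using X(2) nonbases_eq[OF M'] by blast
  have yn: "y \<in> {1..n}" using Zr(1) xy unfolding rsets_def by blast
  \<comment> \<open>A set on which \<open>M\<close> and \<open>M'\<close> disagree in this direction
    cannot be forced, since forced sets are nonbases of both.\<close>
  have restI: "V \<in> {Y\<in>rest M. adj X Y}"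
    if "V \<in> rsets n r" "V \<notin> indeps M" "V \<in> indeps M'" "adj X V" for V
  proof -
    have "V \<notin> forced M" using forced_subset_U[OF M M' D] that(3) U_subset_nonbases[OF M'] nonbases_eq[OF M'] by blast
    then show ?thesis using that nonbases_eq[OF M] unfolding rest_def by blast
  qed
  consider (circuit) "\<forall>z\<in>insert y X. insert y X - {z} \<notin> indeps M"
    | (cocircuit) "\<forall>w. w \<notin> X - {x} \<longrightarrow> insert w (X - {x}) \<notin> indeps M"
    using nonbasis_pair_cases[OF M Xn(1) _ xy(1,2)] Z(1) xy(3) by blast
  then show False
  proof cases
    case circuit
    let ?C = "{z \<in> insert y X. insert y X - {z} \<in> indeps M'}"
    have "insert y X - {x} = Z" using xy by blast
    then have "insert y X - {x} \<in> indeps M'" using Zi by simp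
    then have dep: "?C \<notin> indeps M'"
      using fundamental_circuit_dependent[OF M', of "insert y X" x] xy Xs by simp
    have CX: "?C \<subseteq> X" using Xi' xy(2) by auto
    have "(\<lambda>z. insert y X - {z}) ` ?C \<subseteq> {Y\<in>rest M. adj X Y}"
    proof
      fix V assume "V \<in> (\<lambda>z. insert y X - {z}) ` ?C"
      then obtain z where z: "z \<in> ?C" "V = insert y X - {z}" by blast
      then have zX: "z \<in> X" "V = insert y (X - {z})" using CX xy(2) by auto
      have "V \<in> rsets n r" using swap_rsets[OF Xr zX(1) xy(2) yn] zX(2) by simp
      moreover have "adj X V" using zX xy(2) unfolding adj_def by blast
      ultimately show "V \<in> {Y\<in>rest M. adj X Y}" using restI circuit z by blast
    qed
    then have "card ((\<lambda>z. insert y X - {z}) ` ?C) \<le> card {Y\<in>rest M. adj X Y}"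
      using finite_rest[OF M] by (intro card_mono) auto
    moreover have "inj_on (\<lambda>z. insert y X - {z}) ?C" by (rule inj_onI) blast
    ultimately have "card ?C \<le> q" using rest_degree[OF M X(1)] by (simp add: card_image)
    then have "?C \<in> small_dependent M'" using dep CX Xs(1) unfolding small_dependent_def by blast
    then have "?C \<in> small_dependent M" using D unfolding data_def by simp
    then show False using small_dependent_forced[OF M _ CX Xr] Xn(2) by blast
  next
    case cocircuit
    let ?Y = "X - {x}"
    let ?G = "{w \<in> {1..n}. w \<notin> ?Y \<and> insert w ?Y \<in> indeps M'}"
    have Yi: "?Y \<in> indeps M'" using indep_mono[OF m'(1) Zi] xy(3) by blast
    have cY: "Suc (card ?Y) = r" using Xs xy(1) card_Suc_Diff1[of X x] by simp
    have meets: "?G \<inter> B \<noteq> {}" if B: "B \<in> indeps M'" "card B = r" for B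
    proof -
      obtain w where w: "w \<in> B" "w \<notin> ?Y" "insert w ?Y \<in> indeps M'"
        using fundamental_cocircuit_meets[OF M' cY Yi B] by blast
      then have "w \<in> ?G" using indep_subset_ground[OF m'(1) B(1)] m'(2) by blast
      then show ?thesis using w(1) by blast
    qed
    have GX: "?G \<inter> X = {}" using Xi' by (auto simp: insert_absorb)
    have "(\<lambda>w. insert w ?Y) ` ?G \<subseteq> {Y\<in>rest M. adj X Y}"
    proof
      fix V assume "V \<in> (\<lambda>w. insert w ?Y) ` ?G"
      then obtain w where w: "w \<in> ?G" "V = insert w ?Y" by blast
      then have wX: "w \<notin> X" "w \<in> {1..n}" using GX by auto
      have "V \<in> rsets n r" using swap_rsets[OF Xr xy(1) wX] w(2) by simp
      moreover have "adj X V" using w(2) wX xy(1) unfolding adj_def by blast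
      ultimately show "V \<in> {Y\<in>rest M. adj X Y}" using restI cocircuit w by blast
    qed
    then have "card ((\<lambda>w. insert w ?Y) ` ?G) \<le> card {Y\<in>rest M. adj X Y}"
      using finite_rest[OF M] by (intro card_mono) auto
    moreover have "inj_on (\<lambda>w. insert w ?Y) ?G" by (rule inj_onI) blast
    ultimately have "card ?G \<le> q" using rest_degree[OF M X(1)] by (simp add: card_image)
    then have "?G \<in> small_codependent M'" using meets unfolding small_codependent_def by blast
    then have "?G \<in> small_codependent M" using D unfolding data_def by simp
    then show False using small_codependent_forced[OF M _ GX Xr] Xn(2) by blast
  qed
qed

text \<open>If all neighbours of \<open>X\<close> are forced while \<open>X\<close> is not, the fundamental (co)circuit
  responsible for this in another matroid with the same data is a singleton.\<close>

lemma rest_isolated_W: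
  assumes M: "M \<in> matroids_of_rank n r"
    and loopless: "\<And>e. e \<in> {1..n} \<Longrightarrow> {e} \<in> indeps M"
    and coloopless: "\<And>e. e \<in> {1..n} \<Longrightarrow> \<exists>B\<in>indeps M. card B = r \<and> e \<notin> B"
    and X: "X \<in> rest M" "\<And>Y. Y \<in> rest M \<Longrightarrow> \<not> adj X Y"
  shows "X \<in> W M"
proof (rule ccontr)
  assume "X \<notin> W M"
  have Xn: "X \<in> nonbases M" "X \<notin> forced M" using X(1) unfolding rest_def by auto
  have Xr: "X \<in> rsets n r" using X(1) rest_subset[OF M] by blast
  then have Xs: "X \<subseteq> {1..n}" "card X = r" "finite X" using finite_rset[OF Xr] by (simp_all add: rsets_def)
  obtain Z where Z: "Z \<in> nonbases M" "adj X Z"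
    using W_iff_isolated[OF M r Xn(1)] \<open>X \<notin> W M\<close> by blast
  obtain M' where M': "M' \<in> matroids_of_rank n r" "data M' = data M" "X \<notin> U M'"
    using forcedI[of M X] Xn(2) by blast
  note m' = matroids_of_rankD[OF M'(1)]
  have nbr: "Y \<in> nonbases M'" if "Y \<in> nonbases M" "adj X Y" for Y
  proof -
    have "Y \<in> forced M" using that X(2)[of Y] unfolding rest_def by blast
    then show ?thesis using forced_subset_U[OF M M'(1,2)] U_subset_nonbases[OF M'(1)] by blast
  qed
  \<comment> \<open>The neighbour \<open>Z\<close> is forced, hence a nonbasis of \<open>M'\<close>;
    if \<open>X\<close> were one too, the edge would put \<open>X\<close> into
    \<open>U M'\<close>.\<close>
  have "X \<notin> nonbases M'" using adj_nonbases_U[OF M'(1) _ nbr[OF Z] Z(2)] M'(3) by blast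
  then have Xi': "X \<in> indeps M'" using Xr nonbases_eq[OF M'(1)] by blast
  obtain x y where xy: "x \<in> X" "y \<notin> X" "Z = insert y (X - {x})" using Z(2) unfolding adj_def by blast
  have "Z \<in> rsets n r" using Z(1) nonbases_eq[OF M] by blast
  then have yn: "y \<in> {1..n}" using xy(3) unfolding rsets_def by blast
  consider (circuit) "\<forall>z\<in>insert y X. insert y X - {z} \<notin> indeps M"
    | (cocircuit) "\<forall>w. w \<notin> X - {x} \<longrightarrow> insert w (X - {x}) \<notin> indeps M"
    using nonbasis_pair_cases[OF M Xn(1) _ xy(1,2)] Z(1) xy(3) by blast
  then show False
  proof cases
    case circuit
    have no: "insert y X - {z} \<notin> indeps M'" if z: "z \<in> X" for z
    proof -
      have eq: "insert y X - {z} = insert y (X - {z})" using z xy(2) by blast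
      have "insert y (X - {z}) \<in> nonbases M"
        using swap_rsets[OF Xr z xy(2) yn] circuit z eq nonbases_eq[OF M] by auto
      moreover have "adj X (insert y (X - {z}))" using z xy(2) unfolding adj_def by blast
      ultimately show ?thesis using nbr nonbases_eq[OF M'(1)] eq by auto
    qed
    have yi: "insert y X - {y} \<in> indeps M'" using Xi' xy(2) by simp
    \<comment> \<open>All other deletions are nonbases of \<open>M'\<close>, so \<open>y\<close> is
      a loop of \<open>M'\<close>; as \<open>1 \<le> q\<close>, the data transfer this loop to
      \<open>M\<close>.\<close>
    have "{z \<in> insert y X. insert y X - {z} \<in> indeps M'} = {y}" using no yi by blast
    then have "{y} \<notin> indeps M'"
      using fundamental_circuit_dependent[OF M'(1) _ _ yi] xy(2) Xs by simp
    then have "{y} \<in> small_dependent M'" using yn q unfolding small_dependent_def by simp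
    then have "{y} \<in> small_dependent M" using M'(2) unfolding data_def by simp
    then show False using loopless[OF yn] unfolding small_dependent_def by blast
  next
    case cocircuit
    have no: "insert w (X - {x}) \<notin> indeps M'" if w: "w \<in> {1..n}" "w \<notin> X" for w
    proof -
      have "insert w (X - {x}) \<in> nonbases M"
        using swap_rsets[OF Xr xy(1) w(2,1)] cocircuit w nonbases_eq[OF M] by auto
      moreover have "adj X (insert w (X - {x}))" using w xy(1) unfolding adj_def by blast
      ultimately show ?thesis using nbr nonbases_eq[OF M'(1)] by auto
    qed
    have Yi: "X - {x} \<in> indeps M'" using indep_mono[OF m'(1) Xi'] by blast
    have cY: "Suc (card (X - {x})) = r" using Xs xy(1) card_Suc_Diff1[of X x] by simp
    have xn: "x \<in> {1..n}" using xy(1) Xs(1) by blast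
    \<comment> \<open>The dual case: no element outside \<open>X\<close> completes
      \<open>X - {x}\<close>, so \<open>x\<close> is a coloop of \<open>M'\<close>.\<close>
    have mem: "x \<in> B" if B: "B \<in> indeps M'" "card B = r" for B
    proof -
      obtain w where w: "w \<in> B" "w \<notin> X - {x}" "insert w (X - {x}) \<in> indeps M'"
        using fundamental_cocircuit_meets[OF M'(1) cY Yi B] by blast
      have "w \<in> {1..n}" using indep_subset_ground[OF m'(1) B(1)] m'(2) w(1) by blast
      then have "w \<in> X" using no[of w] w(3) by blast
      then show ?thesis using w(1,2) by blast
    qed
    have "{x} \<in> small_codependent M'" using xn q mem unfolding small_codependent_def by simp
    then have "{x} \<in> small_codependent M" using M'(2) unfolding data_def by simp
    moreover obtain B where "B \<in> indeps M" "card B = r" "x \<notin> B" using coloopless[OF xn] by blast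
    ultimately show False unfolding small_codependent_def by simp
  qed
qed

end

section \<open>Transversals and finiteness\<close>

lemma card_image_le_factor:
  assumes "finite B" "g ` A \<subseteq> B" and "\<And>x y. x \<in> A \<Longrightarrow> y \<in> A \<Longrightarrow> g x = g y \<Longrightarrow> f x = f y"
  shows "card (f ` A) \<le> card B"
proof -
  have "f ` A \<subseteq> (\<lambda>b. f (SOME x. x \<in> A \<and> g x = b)) ` (g ` A)"
  proof
    fix z assume "z \<in> f ` A"
    then obtain x where x: "x \<in> A" "z = f x" by blast
    let ?x = "SOME y. y \<in> A \<and> g y = g x"
    have "?x \<in> A \<and> g ?x = g x" by (rule someI[of _ x]) (use x in simp)
    then have "f ?x = z" using assms(3)[of ?x x] x by simp
    then show "z \<in> (\<lambda>b. f (SOME x. x \<in> A \<and> g x = b)) ` (g ` A)" using x(1) by blast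
  qed
  moreover have fin: "finite (g ` A)" using assms(1,2) finite_subset by blast
  ultimately have "card (f ` A) \<le> card (g ` A)"
    by (meson card_image_le card_mono finite_imageI le_trans)
  also have "\<dots> \<le> card B" using assms(1,2) by (rule card_mono)
  finally show ?thesis .
qed

text \<open>Choice functions are replaced by their images, since only the set of chosen vertices
  enters the encoding; for disjoint parts nothing is lost.\<close>

definition transversals :: "'a set set \<Rightarrow> 'a set set" where
  "transversals \<P> = (\<lambda>f. f ` \<P>) ` (\<Pi>\<^sub>E P\<in>\<P>. P)"

lemma transversal_subset: "T \<in> transversals \<P> \<Longrightarrow> T \<subseteq> \<Union>\<P>"
  unfolding transversals_def by (auto simp: PiE_def Pi_def)

lemma transversal_meets: "T \<in> transversals \<P> \<Longrightarrow> P \<in> \<P> \<Longrightarrow> \<exists>x\<in>T. x \<in> P"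
  unfolding transversals_def by (auto simp: PiE_def Pi_def)

lemma transversal_unique:
  assumes "T \<in> transversals \<P>" "disjoint \<P>" "P \<in> \<P>" "x \<in> T" "y \<in> T" "x \<in> P" "y \<in> P"
  shows "x = y"
proof -
  obtain f where f: "f \<in> (\<Pi>\<^sub>E P\<in>\<P>. P)" "T = f ` \<P>" using assms(1) unfolding transversals_def by blast
  obtain A B where AB: "A \<in> \<P>" "x = f A" "B \<in> \<P>" "y = f B" using assms(4,5) f(2) by blast
  then have "x \<in> A" "y \<in> B" using f(1) by auto
  then have "A = P" "B = P" using AB(1,3) assms(2,3,6,7) unfolding disjoint_def by blast+
  then show ?thesis using AB by simp
qed

lemma card_transversal_le: "finite \<P> \<Longrightarrow> T \<in> transversals \<P> \<Longrightarrow> card T \<le> card \<P>"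
  unfolding transversals_def using card_image_le by auto

lemma two_power_le_card_transversals:
  assumes fin: "finite \<P>" "\<And>P. P \<in> \<P> \<Longrightarrow> finite P" and dis: "disjoint \<P>"
    and two: "\<And>P. P \<in> \<P> \<Longrightarrow> 2 \<le> card P"
  shows "2 ^ card \<P> \<le> card (transversals \<P>)"
proof -
  have "inj_on (\<lambda>f. f ` \<P>) (\<Pi>\<^sub>E P\<in>\<P>. P)"
  proof (rule inj_onI)
    fix f g assume f: "f \<in> (\<Pi>\<^sub>E P\<in>\<P>. P)" and g: "g \<in> (\<Pi>\<^sub>E P\<in>\<P>. P)" and eq: "f ` \<P> = g ` \<P>"
    show "f = g"
    proof (rule PiE_ext[OF f g])
      fix P assume P: "P \<in> \<P>"
      have T: "f ` \<P> \<in> transversals \<P>" using f unfolding transversals_def by blast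
      have "f P \<in> P" "g P \<in> P" using f g P by auto
      moreover have "f P \<in> f ` \<P>" "g P \<in> f ` \<P>" using P eq by auto
      ultimately show "f P = g P" using transversal_unique[OF T dis P] by blast
    qed
  qed
  then have "card (transversals \<P>) = (\<Prod>P\<in>\<P>. card P)"
    unfolding transversals_def using fin(1) by (simp add: card_image card_PiE)
  moreover have "(\<Prod>P\<in>\<P>. 2) \<le> (\<Prod>P\<in>\<P>. card P)" using two by (intro prod_mono) auto
  ultimately show ?thesis by simp
qed

lemma finite_matroids_on: "finite (matroids_on n)"
proof -
  have "matroids_on n \<subseteq> (\<lambda>I. \<lparr>ground = {1..n}, indeps = I\<rparr>) ` Pow (Pow {1..n})"
  proof
    fix M assume "M \<in> matroids_on n"
    then have "matroid M" "ground M = {1..n}" unfolding matroids_on_def matroids_of_rank_def by auto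
    then have "indeps M \<in> Pow (Pow {1..n})" "M = \<lparr>ground = {1..n}, indeps = indeps M\<rparr>"
      using matroidD(2)[of M] by simp_all
    then show "M \<in> (\<lambda>I. \<lparr>ground = {1..n}, indeps = I\<rparr>) ` Pow (Pow {1..n})" by (rule rev_image_eqI)
  qed
  then show ?thesis by (rule finite_subset) simp
qed

lemma finite_matroids_of_rank: "finite (matroids_of_rank n r)"
  by (rule finite_subset[OF _ finite_matroids_on[of n]]) (auto simp: matroids_on_def)

definition stable_sets :: "nat \<Rightarrow> nat \<Rightarrow> nat set set set" where
  "stable_sets n r = {S. S \<subseteq> rsets n r \<and> (\<forall>X\<in>S. \<forall>Y\<in>S. \<not> adj X Y)}"

section \<open>Components of the remainder determine the matroid\<close>

context compression
begin

definition links :: "nat set_system \<Rightarrow> (nat set \<times> nat set) set" where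
  "links M = {(X, Y). X \<in> rest M \<and> Y \<in> rest M \<and> adj X Y}"

definition linked :: "nat set_system \<Rightarrow> nat set set" where
  "linked M = {X \<in> rest M. \<exists>Y\<in>rest M. adj X Y}"

text \<open>The nontrivial connected components of the graph induced on \<open>rest M\<close>.
  Reflexive closure lives on the whole type, so it is restricted to \<open>linked M\<close> to give
  an equivalence there.\<close>

definition parts :: "nat set_system \<Rightarrow> nat set set set" where
  "parts M = linked M // ((links M)\<^sup>* \<inter> linked M \<times> linked M)"

lemma sym_links: "sym (links M)"
  unfolding links_def sym_def using adj_sym by auto

lemma links_linked: "(X, Y) \<in> links M \<Longrightarrow> X \<in> linked M \<and> Y \<in> linked M"
  unfolding links_def linked_def using adj_sym by auto

lemma equiv_parts: "equiv (linked M) ((links M)\<^sup>* \<inter> linked M \<times> linked M)"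
proof (rule equivI)
  show "(links M)\<^sup>* \<inter> linked M \<times> linked M \<subseteq> linked M \<times> linked M" by blast
  show "refl_on (linked M) ((links M)\<^sup>* \<inter> linked M \<times> linked M)" unfolding refl_on_def by auto
  show "sym ((links M)\<^sup>* \<inter> linked M \<times> linked M)"
    using sym_rtrancl[OF sym_links] unfolding sym_def by blast
  show "trans ((links M)\<^sup>* \<inter> linked M \<times> linked M)"
    using trans_rtrancl[of "links M"] unfolding trans_def by blast
qed

lemma Union_parts: "\<Union>(parts M) = linked M"
  unfolding parts_def using Union_quotient[OF equiv_parts] .

lemma disjoint_parts: "disjoint (parts M)"
  unfolding disjoint_def parts_def using quotient_disj[OF equiv_parts] by blast

lemma finite_linked: "M \<in> matroids_of_rank n r \<Longrightarrow> finite (linked M)"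
  using finite_rest unfolding linked_def by simp

lemma finite_parts: "M \<in> matroids_of_rank n r \<Longrightarrow> finite (parts M)"
  unfolding parts_def using finite_linked by (intro finite_quotient) auto

lemma part_closed:
  assumes "P \<in> parts M" "X \<in> P" "(X, Y) \<in> (links M)\<^sup>*" "Y \<in> linked M"
  shows "Y \<in> P"
proof -
  have "X \<in> linked M" using assms(1,2) Union_parts by blast
  then show ?thesis
    using in_quotient_imp_closed[OF equiv_parts assms(1)[unfolded parts_def] assms(2), of Y] assms(3,4)
    by blast
qed

lemma part_connected:
  assumes "P \<in> parts M" "X \<in> P" "Y \<in> P"
  shows "(X, Y) \<in> (links M)\<^sup>*"
  using quotient_eq_iff[OF equiv_parts assms(1)[unfolded parts_def] assms(1)[unfolded parts_def] assms(2,3)]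
  by blast

lemma part_card:
  assumes M: "M \<in> matroids_of_rank n r" and P: "P \<in> parts M"
  shows "2 \<le> card P" "finite P"
proof -
  have sub: "P \<subseteq> linked M" using P Union_parts by blast
  then show fin: "finite P" using finite_linked[OF M] finite_subset by blast
  have "P \<noteq> {}" using in_quotient_imp_non_empty[OF equiv_parts P[unfolded parts_def]] .
  then obtain X where X: "X \<in> P" by blast
  then have "X \<in> linked M" using sub by blast
  then obtain Y where Y: "X \<in> rest M" "Y \<in> rest M" "adj X Y" unfolding linked_def by blast
  then have l: "(X, Y) \<in> links M" unfolding links_def by blast
  then have "Y \<in> P" using part_closed[OF P X] links_linked by blast
  moreover have "X \<noteq> Y" using Y(3) adj_irrefl by blast
  ultimately have "{X, Y} \<subseteq> P" "card {X, Y} = 2" using X by simp_all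
  then have "card {X, Y} \<le> card P" "card {X, Y} = 2" using card_mono[OF fin] by blast+
  then show "2 \<le> card P" by simp
qed

lemma card_transversals_parts:
  assumes "M \<in> matroids_of_rank n r"
  shows "2 ^ card (parts M) \<le> card (transversals (parts M))"
  by (rule two_power_le_card_transversals[OF finite_parts[OF assms] part_card(2)[OF assms]
        disjoint_parts part_card(1)[OF assms]])

lemma linked_subset_U: "M \<in> matroids_of_rank n r \<Longrightarrow> linked M \<subseteq> U M"
  using adj_nonbases_U[of M] unfolding linked_def rest_def by blast

text \<open>An unforced member of \<open>U M\<close> that had no neighbour in \<open>rest M\<close>
  would be in \<open>W M\<close> by \<open>rest_isolated_W\<close>.\<close>

lemma U_eq_forced_linked:
  assumes M: "M \<in> matroids_of_rank n r"
    and loopless: "\<And>e. e \<in> {1..n} \<Longrightarrow> {e} \<in> indeps M"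
    and coloopless: "\<And>e. e \<in> {1..n} \<Longrightarrow> \<exists>B\<in>indeps M. card B = r \<and> e \<notin> B"
  shows "U M = forced M \<union> linked M"
proof
  show "forced M \<union> linked M \<subseteq> U M" using linked_subset_U[OF M] forced_subset_U[OF M M] by simp
  show "U M \<subseteq> forced M \<union> linked M"
  proof
    fix X assume X: "X \<in> U M"
    show "X \<in> forced M \<union> linked M"
    proof (rule ccontr)
      assume n: "X \<notin> forced M \<union> linked M"
      have "X \<in> nonbases M" "X \<notin> W M" using X unfolding U_def by auto
      then have "X \<in> rest M" using n unfolding rest_def by blast
      then show False using rest_isolated_W[OF M loopless coloopless, of X] n \<open>X \<notin> W M\<close>
        unfolding linked_def by blast
    qed
  qed
qed

text \<open>\<open>T\<close> gives a nonbasis of \<open>M'\<close> in each component, and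
  \<open>propagate\<close> carries this along paths. Every linked vertex also has a linked
  neighbour, hence lies in \<open>U M'\<close> and not merely in \<open>nonbases M'\<close>.\<close>

lemma linked_propagate:
  assumes M: "M \<in> matroids_of_rank n r" and M': "M' \<in> matroids_of_rank n r" and D: "data M' = data M"
    and T: "T \<in> transversals (parts M)" "T \<subseteq> nonbases M'"
  shows "linked M \<subseteq> U M'"
proof -
  have step: "Y \<in> nonbases M'" if "(X, Y) \<in> (links M)\<^sup>*" "X \<in> nonbases M'" for X Y
    using that
  proof (induction rule: rtrancl_induct)
    case (step Y Z)
    then have "Y \<in> rest M" "Z \<in> nonbases M" "adj Y Z" unfolding links_def rest_def by auto
    then show ?case using propagate[OF M M' D] step by blast
  qed
  have K: "linked M \<subseteq> nonbases M'"
  proof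
    fix Y assume "Y \<in> linked M"
    then obtain P where P: "P \<in> parts M" "Y \<in> P" using Union_parts by blast
    obtain X where X: "X \<in> T" "X \<in> P" using transversal_meets[OF T(1) P(1)] by blast
    then show "Y \<in> nonbases M'" using step[OF part_connected[OF P(1) X(2) P(2)]] T(2) by blast
  qed
  show ?thesis
  proof
    fix X assume X: "X \<in> linked M"
    then obtain Y where "Y \<in> rest M" "adj X Y" "X \<in> rest M" unfolding linked_def by blast
    then have "Y \<in> linked M" using links_linked[of X Y M] unfolding links_def by blast
    then show "X \<in> U M'" using adj_nonbases_U[OF M' _ _ \<open>adj X Y\<close>] K X by blast
  qed
qed

definition proper :: "nat set_system set" where
  "proper = {M \<in> matroids_of_rank n r. (\<forall>e\<in>{1..n}. {e} \<in> indeps M) \<and>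
     (\<forall>e\<in>{1..n}. \<exists>B\<in>indeps M. card B = r \<and> e \<notin> B)}"

lemma properD: "M \<in> proper \<Longrightarrow> M \<in> matroids_of_rank n r"
  unfolding proper_def by simp

lemma proper_U: "M \<in> proper \<Longrightarrow> U M = forced M \<union> linked M"
  using U_eq_forced_linked[of M] unfolding proper_def by simp

lemma transversal_parts_subset: "T \<in> transversals (parts M) \<Longrightarrow> T \<subseteq> linked M"
  using transversal_subset[of T "parts M"] Union_parts by simp

lemma transversal_nonbases:
  "M \<in> matroids_of_rank n r \<Longrightarrow> T \<in> transversals (parts M) \<Longrightarrow> T \<subseteq> nonbases M"
  using transversal_parts_subset unfolding linked_def rest_def by blast

text \<open>The common transversal consists of nonbases of both matroids, so
  \<open>linked_propagate\<close> applies in both directions; forced sets depend on the data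
  only.\<close>

lemma U_determined:
  assumes M: "M \<in> proper" and M': "M' \<in> proper" and D: "data M' = data M"
    and T: "T \<in> transversals (parts M)" "T \<in> transversals (parts M')"
  shows "U M = U M'"
proof
  note m = properD[OF M] properD[OF M']
  show "U M \<subseteq> U M'"
    using linked_propagate[OF m D T(1) transversal_nonbases[OF m(2) T(2)]]
      forced_subset_U[OF m D] proper_U[OF M] by simp
  show "U M' \<subseteq> U M"
    using linked_propagate[OF m(2,1) D[symmetric] T(2) transversal_nonbases[OF m(1) T(1)]]
      forced_subset_U[OF m(2,1) D[symmetric]] proper_U[OF M'] by simp
qed

lemma nonbases_eq_U_W: "M \<in> matroids_of_rank n r \<Longrightarrow> nonbases M = U M \<union> W M"
  using W_nonbases[of M n r, OF _ _ r(1)] unfolding U_def by auto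

text \<open>Although only the union of circuit-hyperplanes and transversal is given, all its members
  are nonbases of both matroids, which suffices to propagate. Once \<open>M = M'\<close>, the
  transversal is what remains after removing \<open>W M\<close>.\<close>

lemma matroid_determined:
  assumes M: "M \<in> proper" and M': "M' \<in> proper" and D: "data M' = data M"
    and T: "T \<in> transversals (parts M)" "T' \<in> transversals (parts M')"
    and eq: "W M \<union> T = W M' \<union> T'"
  shows "M = M' \<and> T = T'"
proof -
  note m = properD[OF M] properD[OF M']
  have sub: "W A \<union> S \<subseteq> nonbases A" if "A \<in> proper" "S \<in> transversals (parts A)" for A S
    using transversal_nonbases[OF properD[OF that(1)] that(2)] nonbases_eq_U_W[OF properD[OF that(1)]]
    by simp
  have le: "nonbases A \<subseteq> nonbases B"
    if A: "A \<in> proper" "B \<in> proper" "data B = data A" and S: "S \<in> transversals (parts A)"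
      "S' \<in> transversals (parts B)" "W A \<union> S = W B \<union> S'" for A B S S'
  proof -
    have "W A \<union> S \<subseteq> nonbases B" using sub[OF A(2) S(2)] S(3) by simp
    then have "linked A \<subseteq> U B" "W A \<subseteq> nonbases B"
      using linked_propagate[OF properD[OF A(1)] properD[OF A(2)] A(3) S(1)] by auto
    moreover have "forced A \<subseteq> U B" using forced_subset_U properD A by blast
    ultimately show ?thesis
      using proper_U[OF A(1)] nonbases_eq_U_W[OF properD[OF A(1)]] U_subset_nonbases[OF properD[OF A(2)]]
      by auto
  qed
  have "nonbases M = nonbases M'"
    using le[OF M M' D T eq] le[OF M' M D[symmetric] T(2,1) eq[symmetric]] by simp
  then have MM: "M = M'" using matroids_of_rank_eqI[OF m] by simp
  have dis: "S \<inter> W M = {}" if "S \<in> transversals (parts M)" for S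
    using transversal_parts_subset[OF that] linked_subset_U[OF m(1)] unfolding U_def by blast
  have "T = T'" using dis[OF T(1)] dis[of T'] T(2) eq MM by blast
  then show ?thesis using MM by simp
qed

text \<open>Members of \<open>W M\<close> have no nonbasis neighbours, and adjacent members of
  \<open>T\<close> would lie in one component, of which \<open>T\<close> has a single
  vertex.\<close>

lemma W_transversal_stable:
  assumes M: "M \<in> matroids_of_rank n r" and T: "T \<in> transversals (parts M)"
  shows "W M \<union> T \<in> stable_sets n r"
proof -
  have TK: "T \<subseteq> nonbases M" using transversal_nonbases[OF M T] .
  have WK: "W M \<subseteq> nonbases M" using W_nonbases[OF M _ r(1)] by blast
  have W: "\<not> adj X Y" "\<not> adj Y X" if "X \<in> W M" "Y \<in> nonbases M" for X Y
    using W_iff_isolated[OF M r, of X] that WK adj_sym by blast+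
  have "\<not> adj X Y" if XY: "X \<in> T" "Y \<in> T" for X Y
  proof
    assume a: "adj X Y"
    have lk: "X \<in> linked M" "Y \<in> linked M" using transversal_parts_subset[OF T] XY by auto
    then have "(X, Y) \<in> links M" using a unfolding links_def linked_def by blast
    moreover obtain P where P: "P \<in> parts M" "X \<in> P" using lk(1) Union_parts by blast
    ultimately have "Y \<in> P" using part_closed lk(2) by blast
    then have "X = Y" using transversal_unique[OF T disjoint_parts P(1) XY P(2)] by simp
    then show False using a adj_irrefl by blast
  qed
  then have "\<forall>X\<in>W M \<union> T. \<forall>Y\<in>W M \<union> T. \<not> adj X Y" using W TK WK by blast
  moreover have "W M \<union> T \<subseteq> rsets n r" using TK WK nonbases_eq[OF M] by blast
  ultimately show ?thesis unfolding stable_sets_def by simp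
qed

section \<open>Counting matroids with many components and values of U\<close>

definition families :: "nat set set set" where
  "families = {\<F>. \<F> \<subseteq> Pow {1..n} \<and> card \<F> \<le> t}"

definition small_sets :: "nat set set" where
  "small_sets = {A. A \<subseteq> {1..n} \<and> card A \<le> q}"

definition data_range where
  "data_range = (families \<times> families \<times> families) \<times> Pow small_sets \<times> Pow small_sets"

lemma data_in_range: "M \<in> matroids_of_rank n r \<Longrightarrow> data M \<in> data_range"
proof -
  assume M: "M \<in> matroids_of_rank n r"
  obtain \<C> \<H> \<Q> where c: "cover M = (\<C>, \<H>, \<Q>)" by (cases "cover M") auto
  have "cover M \<in> families \<times> families \<times> families"
    using covering_cover[OF M] unfolding c covering_def families_def by simp
  moreover have "small_dependent M \<subseteq> small_sets" "small_codependent M \<subseteq> small_sets"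
    unfolding small_dependent_def small_codependent_def small_sets_def by auto
  ultimately show ?thesis unfolding data_def data_range_def by simp
qed

lemma finite_families: "finite families"
  unfolding families_def by (rule finite_subset[of _ "Pow (Pow {1..n})"]) auto

lemma finite_small_sets: "finite small_sets"
  unfolding small_sets_def by (rule finite_subset[of _ "Pow {1..n}"]) auto

lemma finite_data_range: "finite data_range"
  unfolding data_range_def using finite_families finite_small_sets by simp

lemma card_data_range: "card data_range = card families ^ 3 * 4 ^ card small_sets"
proof -
  have "(4::nat) ^ card small_sets = 2 ^ card small_sets * 2 ^ card small_sets"
    by (simp add: power_mult_distrib[symmetric])
  then show ?thesis unfolding data_range_def using finite_small_sets
    by (simp add: card_cartesian_product card_Pow power3_eq_cube)
qed

lemma finite_proper: "finite proper"
  by (rule finite_subset[OF _ finite_matroids_of_rank[of n r]]) (use properD in blast)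

text \<open>Double counting of pairs of a matroid and a transversal: each matroid has at least
  \<open>2 ^ k\<close> of them, and the pair is recovered from the data and the stable set
  \<open>W M \<union> T\<close>.\<close>

lemma many_parts_rare:
  "card {M \<in> proper. k \<le> card (parts M)} * 2 ^ k \<le> card data_range * card (stable_sets n r)"
proof -
  let ?A = "{M \<in> proper. k \<le> card (parts M)}"
  let ?S = "SIGMA M:?A. transversals (parts M)"
  have fT: "finite (transversals (parts M))" if "M \<in> ?A" for M
  proof -
    have "finite (\<Pi>\<^sub>E P\<in>parts M. P)"
      using that properD finite_parts part_card(2) by (intro finite_PiE) auto
    then show ?thesis unfolding transversals_def by simp
  qed
  have fA: "finite ?A" using finite_proper by simp
  have "(2::nat) ^ k \<le> card (transversals (parts M))" if "M \<in> ?A" for M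
  proof -
    have "(2::nat) ^ k \<le> 2 ^ card (parts M)" using that by (intro power_increasing) auto
    also have "\<dots> \<le> card (transversals (parts M))"
      using that properD card_transversals_parts by blast
    finally show ?thesis .
  qed
  then have "card ?A * 2 ^ k \<le> (\<Sum>M\<in>?A. card (transversals (parts M)))"
    using sum_bounded_below[of ?A "2 ^ k" "\<lambda>M. card (transversals (parts M))"] by simp
  also have "\<dots> = card ?S" using fA fT by (simp add: card_SigmaI)
  also have "\<dots> \<le> card (data_range \<times> stable_sets n r)"
  proof (rule card_inj_on_le)
    show "inj_on (\<lambda>(M, T). (data M, W M \<union> T)) ?S"
    proof (rule inj_onI, clarify)
      fix M T M' T'
      assume "M \<in> proper" "T \<in> transversals (parts M)" "M' \<in> proper" "T' \<in> transversals (parts M')"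
        "data M = data M'" "W M \<union> T = W M' \<union> T'"
      then show "M = M' \<and> T = T'" using matroid_determined[of M M' T T'] by simp
    qed
    show "(\<lambda>(M, T). (data M, W M \<union> T)) ` ?S \<subseteq> data_range \<times> stable_sets n r"
      using data_in_range W_transversal_stable properD by auto
    have "finite (stable_sets n r)" unfolding stable_sets_def
      using rsets_finite by (rule_tac finite_subset[of _ "Pow (rsets n r)"]) auto
    then show "finite (data_range \<times> stable_sets n r)" using finite_data_range by simp
  qed
  also have "\<dots> = card data_range * card (stable_sets n r)" by (simp add: card_cartesian_product)
  finally show ?thesis .
qed

text \<open>\<open>U M\<close> is a function of the data and any one transversal, which has at most
  \<open>k\<close> elements.\<close>

lemma few_U:
  "card (U ` {M \<in> proper. card (parts M) \<le> k}) \<le>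
     card data_range * card {T. T \<subseteq> rsets n r \<and> card T \<le> k}"
proof -
  let ?A = "{M \<in> proper. card (parts M) \<le> k}"
  have "\<exists>T. T \<in> transversals (parts M)" if "M \<in> proper" for M
  proof -
    have "(0::nat) < 2 ^ card (parts M)" by simp
    also have "\<dots> \<le> card (transversals (parts M))"
      using that properD card_transversals_parts by blast
    finally show ?thesis by (metis card.empty ex_in_conv less_irrefl)
  qed
  then obtain \<tau> where \<tau>: "\<And>M. M \<in> proper \<Longrightarrow> \<tau> M \<in> transversals (parts M)" by metis
  have "card (U ` ?A) \<le> card (data_range \<times> {T. T \<subseteq> rsets n r \<and> card T \<le> k})"
  proof (rule card_image_le_factor)
    show "finite (data_range \<times> {T. T \<subseteq> rsets n r \<and> card T \<le> k})"
      using finite_data_range rsets_finite by simp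
    show "(\<lambda>M. (data M, \<tau> M)) ` ?A \<subseteq> data_range \<times> {T. T \<subseteq> rsets n r \<and> card T \<le> k}"
    proof
      fix p assume "p \<in> (\<lambda>M. (data M, \<tau> M)) ` ?A"
      then obtain M where M: "M \<in> proper" "card (parts M) \<le> k" "p = (data M, \<tau> M)" by blast
      have "card (\<tau> M) \<le> k"
        using card_transversal_le[OF finite_parts[OF properD[OF M(1)]] \<tau>[OF M(1)]] M(2) by simp
      moreover have "\<tau> M \<subseteq> rsets n r"
        using transversal_nonbases[OF properD[OF M(1)] \<tau>[OF M(1)]] nonbases_eq[OF properD[OF M(1)]] by blast
      ultimately show "p \<in> data_range \<times> {T. T \<subseteq> rsets n r \<and> card T \<le> k}"
        using data_in_range[OF properD[OF M(1)]] M(3) by simp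
    qed
    fix M M' assume "M \<in> ?A" "M' \<in> ?A" "(data M, \<tau> M) = (data M', \<tau> M')"
    then show "U M = U M'" using U_determined[of M M' "\<tau> M"] \<tau>[of M] \<tau>[of M'] by simp
  qed
  then show ?thesis by (simp add: card_cartesian_product)
qed

end

section \<open>Sparse paving matroids and principal extensions\<close>

lemma matroids_onI: "matroid M \<Longrightarrow> ground M = {1..n} \<Longrightarrow> M \<in> matroids_on n"
  unfolding matroids_on_def matroids_of_rank_def by blast

section \<open>Stable sets as sparse paving matroids\<close>

definition sparse_paving :: "nat \<Rightarrow> nat \<Rightarrow> nat set set \<Rightarrow> nat set_system" where
  "sparse_paving n r S = \<lparr>ground = {1..n}, indeps = {I. I \<subseteq> {1..n} \<and> card I \<le> r \<and> I \<notin> S}\<rparr>"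

text \<open>Augmentation can fail only at size \<open>r - 1\<close>, with every insertion landing in
  \<open>S\<close>. Two such insertions would be adjacent members of \<open>S\<close>, and a single
  one would make \<open>Y\<close> itself a member of \<open>S\<close>.\<close>

lemma matroid_sparse_paving:
  assumes r: "0 < r" and S: "S \<in> stable_sets n r"
  shows "matroid (sparse_paving n r S)"
proof -
  let ?I = "{I. I \<subseteq> {1..n} \<and> card I \<le> r \<and> I \<notin> S}"
  have Sr: "card X = r" if "X \<in> S" for X using that S unfolding stable_sets_def rsets_def by blast
  have fin: "finite X" if "X \<subseteq> {1..n}" for X using finite_subset[OF that] by simp
  have aug: "\<exists>y\<in>Y - X. insert y X \<in> ?I" if X: "X \<in> ?I" and Y: "Y \<in> ?I" and less: "card X < card Y" for X Y
  proof (rule ccontr)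
    assume n: "\<not> ?thesis"
    have f: "finite X" "finite Y" "X \<subseteq> {1..n}" "Y \<subseteq> {1..n}" "card Y \<le> r" "Y \<notin> S" using X Y fin by auto
    have "\<not> Y \<subseteq> X" using less f card_mono by (meson not_less)
    then obtain y where y: "y \<in> Y - X" by blast
    have ins: "insert z X \<in> S" if "z \<in> Y - X" for z
      using n that f less by (auto simp: card_insert_if)
    have cX: "Suc (card X) = r" using Sr[OF ins[OF y]] y f by simp
    have "Y - X \<noteq> {y}"
    proof
      assume e: "Y - X = {y}"
      then have "Y \<subseteq> insert y X" by blast
      moreover have "card (insert y X) \<le> card Y" using y f(1) less by simp
      ultimately have "Y = insert y X" using card_seteq[of "insert y X" Y] f(1) by simp
      then show False using ins[OF y] f(6) by simp
    qed
    then obtain z where z: "z \<in> Y - X" "z \<noteq> y" using y by blast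
    have "insert z X = insert z (insert y X - {y})" using y by auto
    then have "adj (insert y X) (insert z X)" using y z unfolding adj_def by blast
    then show False using ins[OF y] ins[OF z(1)] S unfolding stable_sets_def by blast
  qed
  have down: "Y \<in> ?I" if X: "X \<in> ?I" and "Y \<subseteq> X" for X Y
  proof (cases "Y = X")
    case False
    have "finite X" using X fin by blast
    then have "card Y < card X" using that False by (simp add: psubset_card_mono psubsetI)
    then show ?thesis using that Sr[of Y] by auto
  qed (use X in simp)
  have empty: "{} \<in> ?I" using Sr[of "{}"] r by auto
  show ?thesis unfolding matroid_def sparse_paving_def set_system.select_convs
  proof (intro conjI ballI allI impI)
    show "{} \<in> ?I" by (rule empty)
    show "Y \<in> ?I" if "X \<in> ?I" "Y \<subseteq> X" for X Y using down that .
    show "\<exists>y\<in>Y - X. insert y X \<in> ?I" if "X \<in> ?I" "Y \<in> ?I" "card X < card Y" for X Y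
      using aug that .
  qed auto
qed

text \<open>\<open>S\<close> is recovered as the set of dependent \<open>r\<close>-sets. This turns
  the count in \<open>many_parts_rare\<close> into a fraction of all matroids.\<close>

lemma card_stable_sets_le:
  assumes "0 < r"
  shows "card (stable_sets n r) \<le> card (matroids_on n)"
proof (rule card_inj_on_le)
  show "inj_on (sparse_paving n r) (stable_sets n r)"
  proof (rule inj_on_inverseI)
    fix S assume "S \<in> stable_sets n r"
    then show "rsets n r - indeps (sparse_paving n r S) = S"
      unfolding sparse_paving_def stable_sets_def rsets_def by auto
  qed
  show "sparse_paving n r ` stable_sets n r \<subseteq> matroids_on n"
    using matroid_sparse_paving[OF assms] by (auto intro!: matroids_onI simp: sparse_paving_def)
qed (rule finite_matroids_on)

section \<open>Principal extensions and matroids with a loop or coloop\<close>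

definition principal_extension :: "'a \<Rightarrow> 'a set \<Rightarrow> 'a set set \<Rightarrow> 'a set set" where
  "principal_extension e A \<I> = \<I> \<union> {insert e I | I. I \<in> \<I> \<and> (\<exists>a\<in>A - I. insert a I \<in> \<I>)}"

lemma card_replace:
  assumes "finite (Z - {e})" "e \<in> Z" "a \<notin> Z"
  shows "card (insert a (Z - {e})) = card Z"
proof -
  have "finite Z" using assms(1) by simp
  then show ?thesis using assms(1,3) card_Suc_Diff1[OF _ assms(2)] by simp
qed

text \<open>Deleting \<open>e\<close> and putting it back freely on the flat spanned by
  \<open>A\<close>. In each augmentation \<open>e\<close> is replaced by an element of
  \<open>A\<close> witnessing its independence, and augmentation in the deletion is applied.\<close>

lemma matroid_principal_extension:
  fixes M :: "'a set_system"
  assumes M: "matroid M" and e: "e \<in> ground M" and A: "e \<notin> A"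
  shows "matroid \<lparr>ground = ground M, indeps = principal_extension e A {I \<in> indeps M. e \<notin> I}\<rparr>"
proof -
  let ?I = "{I \<in> indeps M. e \<notin> I}"
  let ?E = "principal_extension e A ?I"
  have aug: "\<exists>y\<in>Y - X. insert y X \<in> ?I" if "X \<in> ?I" "Y \<in> ?I" "card X < card Y" for X Y
    using augment[OF M, of X Y] that by auto
  have fin: "finite X" if "X \<in> ?I" for X using that indep_finite[OF M] by blast
  have mono: "Y \<in> ?I" if "X \<in> ?I" "Y \<subseteq> X" for X Y using that indep_mono[OF M] by blast
  have E_iff: "X \<in> ?E \<longleftrightarrow> (if e \<in> X then X - {e} \<in> ?I \<and> (\<exists>a\<in>A - X. insert a (X - {e}) \<in> ?I) else X \<in> ?I)" for X
  proof (cases "e \<in> X")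
    case True
    have "X \<in> ?E \<longleftrightarrow> (\<exists>I\<in>?I. X = insert e I \<and> (\<exists>a\<in>A - I. insert a I \<in> ?I))"
      using True unfolding principal_extension_def by blast
    also have "\<dots> \<longleftrightarrow> X - {e} \<in> ?I \<and> (\<exists>a\<in>A - (X - {e}). insert a (X - {e}) \<in> ?I)"
    proof
      assume "\<exists>I\<in>?I. X = insert e I \<and> (\<exists>a\<in>A - I. insert a I \<in> ?I)"
      then obtain I where I: "I \<in> ?I" "X = insert e I" "\<exists>a\<in>A - I. insert a I \<in> ?I" by blast
      then have "X - {e} = I" by auto
      then show "X - {e} \<in> ?I \<and> (\<exists>a\<in>A - (X - {e}). insert a (X - {e}) \<in> ?I)" using I by simp
    qed (use True in \<open>intro bexI[of _ "X - {e}"]; auto\<close>)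
    also have "A - (X - {e}) = A - X" using A by blast
    finally show ?thesis using True by simp
  qed (auto simp: principal_extension_def)
  have E_ins: "insert e I \<in> ?E" if "I \<in> ?I" "a \<in> A" "a \<notin> I" "insert a I \<in> ?I" for I a
    using that unfolding principal_extension_def by blast
  have augE: "\<exists>y\<in>Y - X. insert y X \<in> ?E" if X: "X \<in> ?E" and Y: "Y \<in> ?E" and less: "card X < card Y" for X Y
  proof (cases "e \<in> X")
    case eX: False
    then have Xi: "X \<in> ?I" using X E_iff by simp
    show ?thesis
    proof (cases "e \<in> Y")
      case False
      then have "Y \<in> ?I" using Y E_iff by simp
      then show ?thesis using aug[OF Xi _ less] unfolding principal_extension_def by blast
    next
      case True
      then obtain a where a: "a \<in> A" "a \<notin> Y" "insert a (Y - {e}) \<in> ?I" using Y E_iff by auto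
      have "finite (Y - {e})" using fin[OF a(3)] by simp
      then have "card (insert a (Y - {e})) = card Y" using card_replace[OF _ True a(2)] by simp
      then obtain y where y: "y \<in> insert a (Y - {e}) - X" "insert y X \<in> ?I"
        using aug[OF Xi a(3)] less by auto
      show ?thesis
      proof (cases "y = a")
        case True
        then have "insert e X \<in> ?E" using E_ins[OF Xi a(1)] y by simp
        then show ?thesis using \<open>e \<in> Y\<close> eX by blast
      next
        case False
        then show ?thesis using y unfolding principal_extension_def by blast
      qed
    qed
  next
    case eX: True
    let ?X = "X - {e}"
    obtain a where a: "a \<in> A" "a \<notin> X" "insert a ?X \<in> ?I" and Xi: "?X \<in> ?I" using X E_iff eX by auto
    have fX: "finite ?X" using fin Xi by blast
    have cX: "card (insert a ?X) = card X" using card_replace[OF fX eX a(2)] .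
    have good: "\<exists>y\<in>Y - X. insert y X \<in> ?E"
      if y: "y \<in> Y - X" "b \<in> A" "b \<notin> insert y ?X" "insert b (insert y ?X) \<in> ?I" for y b
    proof -
      have "insert y ?X \<in> ?I" using mono[OF y(4)] by blast
      then have "insert e (insert y ?X) \<in> ?E" using E_ins y by blast
      moreover have "insert e (insert y ?X) = insert y X" using eX by blast
      ultimately show ?thesis using y(1) by auto
    qed
    have direct: ?thesis if y: "y \<in> Y - X" "y \<noteq> a" "insert y (insert a ?X) \<in> ?I" for y
      using good[of y a] y a by (simp add: insert_commute)
    show ?thesis
    proof (cases "e \<in> Y")
      case False
      then have Yi: "Y \<in> ?I" using Y E_iff by simp
      obtain y where y: "y \<in> Y - insert a ?X" "insert y (insert a ?X) \<in> ?I"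
        using aug[OF a(3) Yi] less cX by auto
      then have "y \<in> Y - X" "y \<noteq> a" using False by auto
      then show ?thesis using direct y by blast
    next
      case eY: True
      let ?Y = "Y - {e}"
      obtain a' where a': "a' \<in> A" "a' \<notin> Y" "insert a' ?Y \<in> ?I" and Yi: "?Y \<in> ?I" using Y E_iff eY by auto
      have fY: "finite ?Y" using fin Yi by blast
      have cY: "card (insert a' ?Y) = card Y" using card_replace[OF fY eY a'(2)] .
      obtain y where y: "y \<in> insert a' ?Y - insert a ?X" "insert y (insert a ?X) \<in> ?I"
        using aug[OF a(3) a'(3)] less cX cY by auto
      show ?thesis
      proof (cases "y = a'")
        case False
        then show ?thesis using direct[of y] y by blast
      next
        \<comment> \<open>Augmentation returned only the stand-in \<open>a'\<close> of
          \<open>e\<close>. Both \<open>a\<close> and \<open>a'\<close> are now available over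
          \<open>?X\<close>: augment \<open>?X\<close> by some \<open>z\<close> from
          \<open>?Y\<close>, and then by \<open>a\<close> or \<open>a'\<close>, which witnesses that
          \<open>insert z X\<close> is independent.\<close>
        case True
        have "card X = Suc (card ?X)" "card Y = Suc (card ?Y)"
          using card_Suc_Diff1[OF _ eX] card_Suc_Diff1[OF _ eY] fX fY by simp_all
        then have "card ?X < card ?Y" using less by simp
        then obtain z where z: "z \<in> ?Y - ?X" "insert z ?X \<in> ?I" using aug[OF Xi Yi] by auto
        have ne: "a' \<noteq> a" "a' \<notin> ?X" using True y by auto
        have "card (insert z ?X) = Suc (card ?X)" using card_insert_disjoint[OF fX] z(1) by blast
        moreover have "card (insert a ?X) = Suc (card ?X)" using card_insert_disjoint[OF fX] a(2) by blast
        moreover have "card (insert y (insert a ?X)) = Suc (card (insert a ?X))"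
          using card_insert_disjoint[of "insert a ?X" y] fX y(1) by simp
        ultimately have "card (insert z ?X) < card (insert y (insert a ?X))" by simp
        then obtain b where b: "b \<in> insert y (insert a ?X) - insert z ?X" "insert b (insert z ?X) \<in> ?I"
          using aug[OF z(2) y(2)] by auto
        then have "b \<in> A" using True a a' by auto
        moreover have "z \<in> Y - X" using z by blast
        ultimately show ?thesis using good[of z b] b by blast
      qed
    qed
  qed
  have downE: "Y \<in> ?E" if X: "X \<in> ?E" and sub: "Y \<subseteq> X" for X Y
  proof (cases "e \<in> Y")
    case True
    then have "e \<in> X" using sub by blast
    then obtain a where a: "a \<in> A" "a \<notin> X" "insert a (X - {e}) \<in> ?I" using X E_iff[of X] by auto
    then have "insert a (Y - {e}) \<in> ?I" "Y - {e} \<in> ?I"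
      by (intro mono[OF a(3)] insert_mono Diff_mono sub subset_refl subset_insertI2)+
    then show ?thesis using E_iff[of Y] True a sub by auto
  next
    case False
    have "X - {e} \<in> ?I" using X E_iff[of X] by (cases "e \<in> X") auto
    then have "Y \<in> ?I" by (rule mono) (use sub False in blast)
    then show ?thesis unfolding principal_extension_def by blast
  qed
  have "?E \<subseteq> Pow (ground M)"
    using indep_subset_ground[OF M] e unfolding principal_extension_def by blast
  moreover have "{} \<in> ?E" using matroidD(3)[OF M] unfolding principal_extension_def by blast
  ultimately show ?thesis unfolding matroid_def using matroidD(1)[OF M] augE downE by simp
qed

text \<open>Each \<open>M\<close> yields \<open>2 ^ (r - 1)\<close> extensions of its deletion, one
  for every subset \<open>A\<close> of an independent \<open>(r - 1)\<close>-set \<open>b M\<close>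
  avoiding \<open>e\<close>. The deletion gives back \<open>M\<close> by injectivity, and
  \<open>A\<close> can be read off, so all these matroids are distinct.\<close>

lemma few_determined_by_deletion:
  assumes L: "\<L> \<subseteq> matroids_of_rank n r" and e: "e \<in> {1..n}"
    and inj: "inj_on (\<lambda>M. {I \<in> indeps M. e \<notin> I}) \<L>"
  shows "card \<L> * 2 ^ (r - 1) \<le> card (matroids_on n)"
proof -
  have "\<forall>M\<in>\<L>. \<exists>B. B \<in> indeps M \<and> e \<notin> B \<and> card B = r - 1"
  proof
    fix M assume M: "M \<in> \<L>"
    then have Mr: "M \<in> matroids_of_rank n r" using L by blast
    then obtain B where B: "B \<in> indeps M" "card B = r" using matroids_of_rank_base by blast
    note m = matroids_of_rankD[OF Mr]
    have fB: "finite B" using indep_finite[OF m(1) B(1)] .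
    show "\<exists>B. B \<in> indeps M \<and> e \<notin> B \<and> card B = r - 1"
    proof (cases "B = {}")
      case True
      then show ?thesis using B by (intro exI[of _ "{}"]) auto
    next
      case False
      then obtain x where x: "x \<in> B" "e \<in> B \<longrightarrow> x = e" by blast
      have "B - {x} \<in> indeps M" using indep_mono[OF m(1) B(1)] by blast
      then show ?thesis using x B fB by (intro exI[of _ "B - {x}"]) auto
    qed
  qed
  then obtain b where b: "\<And>M. M \<in> \<L> \<Longrightarrow> b M \<in> indeps M \<and> e \<notin> b M \<and> card (b M) = r - 1" by metis
  let ?d = "\<lambda>M. {I \<in> indeps M. e \<notin> I}"
  let ?ext = "\<lambda>(M, A). \<lparr>ground = {1..n}, indeps = principal_extension e A (?d M)\<rparr>"
  let ?S = "SIGMA M:\<L>. Pow (b M)"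
  have fb: "finite (b M)" if "M \<in> \<L>" for M
    using b[OF that] indep_finite matroids_of_rankD(1) L that by blast
  have fL: "finite \<L>" using finite_subset[OF L finite_matroids_of_rank] .
  have rec_d: "{I \<in> principal_extension e A (?d M). e \<notin> I} = ?d M" for M :: "nat set_system" and A
    unfolding principal_extension_def by blast
  \<comment> \<open>For \<open>A\<close> inside \<open>b M\<close>, the only element of
    \<open>A\<close> that can lie outside \<open>b M - {a}\<close> is \<open>a\<close>
    itself.\<close>
  have rec_A: "{a \<in> b M. insert e (b M - {a}) \<in> principal_extension e A (?d M)} = A"
    if M: "M \<in> \<L>" and A: "A \<subseteq> b M" for M A
  proof -
    have "insert e (b M - {a}) \<in> principal_extension e A (?d M) \<longleftrightarrow> a \<in> A" if a: "a \<in> b M" for a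
    proof
      assume "insert e (b M - {a}) \<in> principal_extension e A (?d M)"
      then obtain I where I: "insert e (b M - {a}) = insert e I" "I \<in> ?d M" "\<exists>c\<in>A - I. insert c I \<in> ?d M"
        unfolding principal_extension_def by blast
      have "e \<notin> I" "e \<notin> b M - {a}" using I(2) b[OF M] by auto
      then have "I = b M - {a}" using insert_ident[of e "b M - {a}" I] I(1) by simp
      then show "a \<in> A" using I(3) A by blast
    next
      assume aA: "a \<in> A"
      have "insert a (b M - {a}) \<in> ?d M" "a \<in> A - (b M - {a})"
        using b[OF M] aA a by (auto simp: insert_absorb)
      moreover have "b M - {a} \<in> ?d M"
        using b[OF M] indep_mono[of M "b M" "b M - {a}"] matroids_of_rankD(1) L M by blast
      ultimately show "insert e (b M - {a}) \<in> principal_extension e A (?d M)"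
        unfolding principal_extension_def by blast
    qed
    then show ?thesis using A by blast
  qed
  have "card \<L> * 2 ^ (r - 1) = (\<Sum>M\<in>\<L>. card (Pow (b M)))"
    using b fb by (simp add: card_Pow)
  also have "\<dots> = card ?S" using fL fb by (simp add: card_SigmaI)
  also have "\<dots> \<le> card (matroids_on n)"
  proof (rule card_inj_on_le)
    show "inj_on ?ext ?S"
    proof (rule inj_onI)
      fix p p' assume p: "p \<in> ?S" "p' \<in> ?S" and ext: "?ext p = ?ext p'"
      obtain M A M' A' where pM: "p = (M, A)" "p' = (M', A')" by (metis surj_pair)
      have M: "M \<in> \<L>" "M' \<in> \<L>" and A: "A \<subseteq> b M" "A' \<subseteq> b M'" using p unfolding pM by auto
      have "\<lparr>ground = {1..n}, indeps = principal_extension e A (?d M)\<rparr> =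
             \<lparr>ground = {1..n}, indeps = principal_extension e A' (?d M')\<rparr>"
        using ext unfolding pM by simp
      then have eq: "principal_extension e A (?d M) = principal_extension e A' (?d M')" by simp
      then have "?d M = ?d M'" using rec_d[of A M] rec_d[of A' M'] by simp
      then have MM: "M = M'" by (rule inj_onD[OF inj _ M])
      have "A = {a \<in> b M. insert e (b M - {a}) \<in> principal_extension e A (?d M)}"
        using rec_A[OF M(1) A(1)] by (rule sym)
      also have "\<dots> = {a \<in> b M'. insert e (b M' - {a}) \<in> principal_extension e A' (?d M')}"
        unfolding MM eq[unfolded MM] by (rule refl)
      also have "\<dots> = A'" using rec_A[OF M(2) A(2)] .
      finally show "p = p'" using MM pM by simp
    qed
    show "?ext ` ?S \<subseteq> matroids_on n"
    proof
      fix N assume "N \<in> ?ext ` ?S"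
      then obtain M A where M: "M \<in> \<L>" "A \<subseteq> b M"
        and N: "N = \<lparr>ground = {1..n}, indeps = principal_extension e A (?d M)\<rparr>" by auto
      then have "M \<in> matroids_of_rank n r" using L by blast
      note m = matroids_of_rankD[OF this]
      have "e \<notin> A" using M b by blast
      then have "matroid N"
        using matroid_principal_extension[OF m(1), of e A] e unfolding m(2) N by simp
      then show "N \<in> matroids_on n" using N by (intro matroids_onI) simp_all
    qed
  qed (rule finite_matroids_on)
  finally show ?thesis .
qed

text \<open>If \<open>e\<close> is a loop, deleting it does not change the independent sets.\<close>

lemma few_with_loop:
  assumes "e \<in> {1..n}"
  shows "card {M \<in> matroids_of_rank n r. {e} \<notin> indeps M} * 2 ^ (r - 1) \<le> card (matroids_on n)"
proof (rule few_determined_by_deletion[OF _ assms])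
  have "{I \<in> indeps M. e \<notin> I} = indeps M" if "M \<in> matroids_of_rank n r" "{e} \<notin> indeps M" for M
    using indep_mono[OF matroids_of_rankD(1)[OF that(1)], of _ "{e}"] that(2) by blast
  then show "inj_on (\<lambda>M. {I \<in> indeps M. e \<notin> I}) {M \<in> matroids_of_rank n r. {e} \<notin> indeps M}"
    by (intro inj_onI) (auto dest!: matroids_of_rankD(2))
qed blast

text \<open>If \<open>e\<close> is a coloop, the independent sets are those of the deletion, with or
  without \<open>e\<close>.\<close>

lemma few_with_coloop:
  assumes "e \<in> {1..n}"
  shows "card {M \<in> matroids_of_rank n r. \<forall>B\<in>indeps M. card B = r \<longrightarrow> e \<in> B} * 2 ^ (r - 1)
    \<le> card (matroids_on n)"
proof (rule few_determined_by_deletion[OF _ assms])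
  let ?d = "\<lambda>M. {I \<in> indeps M. e \<notin> I}"
  let ?L = "{M \<in> matroids_of_rank n r. \<forall>B\<in>indeps M. card B = r \<longrightarrow> e \<in> B}"
  have eq: "indeps M = ?d M \<union> insert e ` ?d M" if M: "M \<in> ?L" for M
  proof
    have Mr: "M \<in> matroids_of_rank n r" using M by blast
    note m = matroids_of_rankD[OF Mr]
    show "?d M \<union> insert e ` ?d M \<subseteq> indeps M"
    proof
      fix J assume "J \<in> ?d M \<union> insert e ` ?d M"
      then obtain I where I: "I \<in> indeps M" "J \<subseteq> insert e I" by blast
      obtain B where B: "B \<in> indeps M" "card B = r" using matroids_of_rank_base[OF Mr] by blast
      then obtain Z where Z: "Z \<in> indeps M" "I \<subseteq> Z" "card Z = r"
        using extend_indep[OF m(1) I(1) B(1)] matroids_of_rank_card[OF Mr I(1)] by auto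
      then have "J \<subseteq> Z" using M I(2) by blast
      then show "J \<in> indeps M" using indep_mono[OF m(1) Z(1)] by blast
    qed
    show "indeps M \<subseteq> ?d M \<union> insert e ` ?d M"
    proof
      fix J assume J: "J \<in> indeps M"
      show "J \<in> ?d M \<union> insert e ` ?d M"
      proof (cases "e \<in> J")
        case True
        then have "J = insert e (J - {e})" by blast
        moreover have "J - {e} \<in> ?d M" using indep_mono[OF m(1) J] by blast
        ultimately show ?thesis by blast
      qed (use J in simp)
    qed
  qed
  show "inj_on ?d ?L"
  proof (rule inj_onI)
    fix M M' assume M: "M \<in> ?L" "M' \<in> ?L" "?d M = ?d M'"
    then have "indeps M = indeps M'" using eq[OF M(1)] eq[OF M(2)] by simp
    moreover have "ground M = ground M'" using M matroids_of_rankD(2) by auto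
    ultimately show "M = M'" by simp
  qed
qed blast

lemma (in compression) improper_rare:
  "card (matroids_of_rank n r - proper) * 2 ^ (r - 1) \<le> 2 * n * card (matroids_on n)"
proof -
  let ?m = "card (matroids_on n)"
  let ?A = "\<lambda>e. {M \<in> matroids_of_rank n r. {e} \<notin> indeps M}"
  let ?B = "\<lambda>e. {M \<in> matroids_of_rank n r. \<forall>B\<in>indeps M. card B = r \<longrightarrow> e \<in> B}"
  have "matroids_of_rank n r - proper \<subseteq> (\<Union>e\<in>{1..n}. ?A e \<union> ?B e)" unfolding proper_def by blast
  then have "card (matroids_of_rank n r - proper) \<le> card (\<Union>e\<in>{1..n}. ?A e \<union> ?B e)"
    using finite_matroids_of_rank by (intro card_mono) auto
  also have "\<dots> \<le> (\<Sum>e\<in>{1..n}. card (?A e) + card (?B e))"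
    by (intro order_trans[OF card_UN_le] sum_mono card_Un_le) auto
  finally have "card (matroids_of_rank n r - proper) * 2 ^ (r - 1)
      \<le> (\<Sum>e\<in>{1..n}. card (?A e) + card (?B e)) * 2 ^ (r - 1)" by simp
  also have "\<dots> = (\<Sum>e\<in>{1..n}. card (?A e) * 2 ^ (r - 1) + card (?B e) * 2 ^ (r - 1))"
    by (simp only: sum_distrib_right distrib_right)
  also have "\<dots> \<le> (\<Sum>e\<in>{1..n}. ?m + ?m)"
    by (intro sum_mono add_mono few_with_loop few_with_coloop)
  also have "\<dots> = 2 * n * ?m" by simp
  finally show ?thesis .
qed

section \<open>Asymptotics\<close>

text \<open>Exponential weighting: as \<open>y \<le> 1\<close>, each counted \<open>T\<close> has
  weight \<open>y ^ card T\<close> at least \<open>y ^ k\<close>, and all subsets together weigh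
  \<open>(1 + y) ^ card A\<close>.\<close>

lemma card_small_subsets_le:
  fixes y :: real
  assumes A: "finite A" and y: "0 < y" "y \<le> 1"
  shows "real (card {T. T \<subseteq> A \<and> card T \<le> k}) \<le> (1 / y) ^ k * (1 + y) ^ card A"
proof -
  have "real (card {T. T \<subseteq> A \<and> card T \<le> k}) * y ^ k = (\<Sum>T\<in>{T. T \<subseteq> A \<and> card T \<le> k}. y ^ k)" by simp
  also have "\<dots> \<le> (\<Sum>T\<in>{T. T \<subseteq> A \<and> card T \<le> k}. y ^ card T)"
    using y by (intro sum_mono power_decreasing) auto
  also have "\<dots> \<le> (\<Sum>T\<in>Pow A. y ^ card T)"
    using A y by (intro sum_mono2) auto
  also have "\<dots> = (\<Prod>a\<in>A. y + 1)" by (subst prod_add[OF A]) simp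
  finally show ?thesis using y by (simp add: field_simps)
qed

lemma card_small_subsets_le_exp:
  fixes y :: real
  assumes "finite A" "0 < y" "y \<le> 1"
  shows "real (card {T. T \<subseteq> A \<and> card T \<le> k}) \<le> (1 / y) ^ k * exp (y * real (card A))"
proof -
  have "(1 + y) ^ card A \<le> exp y ^ card A" using assms by (intro power_mono exp_ge_add_one_self_aux) auto
  then show ?thesis using card_small_subsets_le[OF assms, of k] assms(2)
    by (smt (verit) exp_of_nat_mult mult.commute mult_left_mono zero_le_divide_1_iff zero_le_power)
qed

lemma card_quarter_subsets_le:
  assumes "4 * k \<le> n"
  shows "real (card {T. T \<subseteq> {1..n} \<and> card T \<le> k}) \<le> (15/8) ^ n"
proof -
  have "real (card {T. T \<subseteq> {1..n} \<and> card T \<le> k}) \<le> 4 ^ k * (5/4) ^ n"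
    using card_small_subsets_le[of "{1..n}" "1/4" k] by simp
  \<comment> \<open>The bound \<open>4 \<le> (3/2) ^ 4\<close> gives the base
    \<open>3/2 * 5/4 = 15/8\<close>, which is below 2.\<close>
  also have "(4::real) ^ k \<le> ((3/2) ^ 4) ^ k" by (intro power_mono) (auto simp: power4_eq_xxxx)
  also have "\<dots> = (3/2) ^ (4 * k)" by (simp only: power_mult)
  also have "\<dots> \<le> (3/2) ^ n" using assms by (intro power_increasing) auto
  finally show ?thesis by (simp add: power_mult_distrib[symmetric])
qed

section \<open>The central binomial coefficient as unit of size\<close>

lemma central_binomial_ge: "2 ^ n \<le> (real n + 1) * real (n choose (n div 2))"
proof -
  have "(\<Sum>k\<le>n. n choose k) \<le> (\<Sum>k\<le>n. n choose (n div 2))" by (intro sum_mono binomial_maximum)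
  then have "2 ^ n \<le> (n + 1) * (n choose (n div 2))" by (simp add: choose_row_sum)
  then have "real (2 ^ n) \<le> real ((n + 1) * (n choose (n div 2)))" by (rule of_nat_mono)
  then show ?thesis by (simp add: algebra_simps)
qed

definition scale :: "nat \<Rightarrow> real" where
  "scale n = real (n choose (n div 2)) / (real n)^2"

text \<open>The inequalities absorb lower-order terms: families of small sets, binomials of outer
  ranks, and \<open>n\<close> itself all fit into one unit \<open>scale n\<close>.\<close>

definition large :: "nat \<Rightarrow> bool" where
  "large n \<longleftrightarrow> 8 \<le> n \<and> (15/8) ^ n \<le> scale n \<and> real n \<le> scale n"

lemma eventually_large: "eventually large sequentially"
proof -
  have 1: "eventually (\<lambda>n. (15/8) ^ n * ((real n + 1) * (real n)^2) \<le> 2 ^ n) sequentially" by real_asymp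
  have 2: "eventually (\<lambda>n. real n * ((real n + 1) * (real n)^2) \<le> 2 ^ n) sequentially" by real_asymp
  show ?thesis using 1 2 eventually_ge_at_top[of 8]
  proof eventually_elim
    case (elim n)
    have pos: "0 < (real n + 1) * (real n)^2" using elim(3) by simp
    have "2 ^ n / ((real n + 1) * (real n)^2) \<le> scale n"
    proof -
      have "2 ^ n / ((real n + 1) * (real n)^2) \<le>
          ((real n + 1) * real (n choose (n div 2))) / ((real n + 1) * (real n)^2)"
        using central_binomial_ge[of n] pos by (intro divide_right_mono) auto
      also have "\<dots> = scale n" unfolding scale_def by simp
      finally show ?thesis .
    qed
    moreover have "(15/8) ^ n \<le> 2 ^ n / ((real n + 1) * (real n)^2)"
      "real n \<le> 2 ^ n / ((real n + 1) * (real n)^2)"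
      using elim(1,2) pos by (simp_all only: pos_le_divide_eq)
    ultimately show ?case using elim(3) unfolding large_def by linarith
  qed
qed

lemma largeD:
  assumes "large n"
  shows "8 \<le> n" "(15/8) ^ n \<le> scale n" "real n \<le> scale n" "1 \<le> scale n" "3 \<le> log 2 (real n)"
    "real (n choose (n div 2)) = scale n * (real n)^2"
proof -
  show n: "8 \<le> n" "(15/8) ^ n \<le> scale n" "real n \<le> scale n" using assms unfolding large_def by auto
  then show "1 \<le> scale n" by linarith
  show "real (n choose (n div 2)) = scale n * (real n)^2" using n(1) unfolding scale_def by simp
  have "log 2 (2 ^ 3) \<le> log 2 (real n)" using n(1) by (intro log_mono) auto
  moreover have "log 2 ((2::real) ^ 3) = 3" by (subst log_nat_power) auto
  ultimately show "3 \<le> log 2 (real n)" by linarith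
qed

text \<open>Two greedy phases. Density first guarantees large degrees and shrinks \<open>A\<close>
  to size \<open>a\<close> in about \<open>16 * scale n * ln n\<close> rounds; then only vertices of
  degree above \<open>n div 8\<close> are picked, at most \<open>128 * scale n\<close> of
  them.\<close>

lemma dominating_set:
  assumes n: "large n" and r: "n \<le> 4 * r" "4 * r \<le> 3 * n" and A: "A \<subseteq> rsets n r"
  shows "\<exists>S\<subseteq>A. real (card S) \<le> 145 * scale n * log 2 (real n) \<and>
    (\<forall>v\<in>A - closed_nbhd adj S. card {u\<in>A - closed_nbhd adj S. adj v u} \<le> n div 8)"
proof -
  note l = largeD[OF n]
  define N where "N = real (n choose (n div 2))"
  define x where "x = scale n"
  have x1: "1 \<le> x" "real n \<le> x" using l unfolding x_def by auto
  have Nx: "N = x * (real n)^2" using l(6) unfolding N_def x_def .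
  have n0: "real n > 0" using l(1) by simp
  have N0: "N > 0" using x1 n0 unfolding Nx by simp
  have finA: "finite A" using A rsets_finite finite_subset[of A] by auto
  have NrN: "real (n choose r) \<le> N" unfolding N_def using binomial_maximum[of n r] by simp
  have rr: "real n \<le> 4 * real r" "4 * real r \<le> 3 * real n" using r by linarith+
  have r0: "0 < r" "r \<le> n" using r l(1) by linarith+
  have Nr0: "0 < real (n choose r)" using r0 by simp
  have cardA: "real (card A) \<le> N"
    using card_mono[OF rsets_finite A] NrN unfolding card_rsets by linarith
  \<comment> \<open>Above size \<open>a\<close> the term \<open>- r\<close> in
    \<open>johnson_dense_vertex\<close> costs at most half of the main term, and \<open>c\<close> is
    a degree fraction that then remains for ranks in the middle half.\<close>
  define a where "a = 16 * N / real n"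
  define c where "c = (real n)^2 / (16 * N)"
  have c01: "0 \<le> c" "c \<le> 1" unfolding c_def Nx using x1 n0 by (simp_all add: field_simps)
  have deg: "\<exists>v\<in>R. real (card {u\<in>R. adj v u}) \<ge> c * real (card R)"
    if R: "R \<subseteq> A" "real (card R) > a" for R
  proof -
    have "a \<ge> 0" unfolding a_def using N0 by simp
    then have "R \<noteq> {}" using R(2) by auto
    then obtain v where v: "v \<in> R" "real (card {u\<in>R. adj v u}) \<ge>
        real r * (real n - real r + 1) * real (card R) / real (n choose r) - real r"
      using johnson_dense_vertex[of R n r] R(1) A r0 by blast
    define \<rho> where "\<rho> = real (card R) / N"
    have \<rho>: "\<rho> * real n \<ge> 16" using R(2) N0 n0 unfolding \<rho>_def a_def by (simp add: field_simps)
    have \<rho>0: "\<rho> \<ge> 0" unfolding \<rho>_def using N0 by simp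
    have "4 * (real n - real r + 1) \<ge> real n" using rr by (simp add: algebra_simps)
    then have "\<rho> * real n \<le> \<rho> * (4 * (real n - real r + 1))" using \<rho>0 by (intro mult_left_mono)
    then have ge2: "2 \<le> \<rho> * (real n - real r + 1)" using \<rho> by linarith
    \<comment> \<open>The product is nonnegative exactly on the allowed ranks and expands to
      \<open>quad\<close>, bounding \<open>r * (n - r)\<close> from below by a multiple of
      \<open>n ^ 2\<close>.\<close>
    have "(4 * real r - real n) * (3 * real n - 4 * real r) \<ge> 0" using rr by (intro mult_nonneg_nonneg) auto
    then have quad: "3 * (real n)^2 \<le> 16 * (real r * (real n - real r))"
      by (simp add: power2_eq_square algebra_simps)
    have "c * real (card R) = \<rho> * (real n)^2 / 16" unfolding c_def \<rho>_def using N0 by (simp add: field_simps)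
    also have "\<dots> \<le> \<rho> * (real r * (real n - real r)) / 2"
    proof -
      have "\<rho> * (3 * (real n)^2) \<le> \<rho> * (16 * (real r * (real n - real r)))"
        using quad \<rho>0 by (rule mult_left_mono)
      moreover have "0 \<le> \<rho> * (real n)^2" using \<rho>0 by simp
      ultimately show ?thesis by (simp add: algebra_simps)
    qed
    also have "\<dots> \<le> real r * (\<rho> * (real n - real r + 1)) / 2"
    proof -
      have "0 \<le> \<rho> * real r" using \<rho>0 by simp
      then have "\<rho> * (real r * (real n - real r)) \<le> real r * (\<rho> * (real n - real r + 1))"
        by (simp add: algebra_simps)
      then show ?thesis by simp
    qed
    also have "\<dots> \<le> real r * (\<rho> * (real n - real r + 1)) - real r"
    proof -
      have "real r * e / 2 \<le> real r * e - real r" if "2 \<le> e" for e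
        using mult_left_mono[OF that, of "real r"] by (simp add: mult.commute)
      then show ?thesis using ge2 .
    qed
    also have "\<dots> = real r * (real n - real r + 1) * real (card R) / N - real r"
      unfolding \<rho>_def by simp
    also have "\<dots> \<le> real r * (real n - real r + 1) * real (card R) / real (n choose r) - real r"
      using NrN Nr0 rr n0 N0 by (intro diff_right_mono divide_left_mono mult_nonneg_nonneg mult_pos_pos) auto
    finally show ?thesis using v by (intro bexI[of _ v]) linarith+
  qed
  \<comment> \<open>With \<open>k\<close> rounds,
    \<open>(1 - c) ^ k \<le> exp (- (c * k)) \<le> 1 / n\<close>, so at most \<open>N / n\<close>
    vertices would remain, which is below \<open>a\<close>.\<close>
  define k where "k = nat \<lceil>ln (real n) / c\<rceil>"
  have c0: "c > 0" unfolding c_def using N0 n0 by simp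
  have lnn: "0 \<le> ln (real n)" using l(1) by simp
  have a0: "0 \<le> a" unfolding a_def using N0 by simp
  obtain S where S: "S \<subseteq> A" "card S \<le> k"
    "real (card (A - closed_nbhd adj S)) \<le> max a ((1 - c) ^ k * real (card A))"
    using greedy_dominate[OF finA c01 a0 deg, of k] by blast
  have kge: "ln (real n) \<le> c * real k" unfolding k_def using c0 lnn
    by (simp add: field_simps) (smt (verit) le_of_int_ceiling divide_le_eq mult.commute of_nat_nat zero_le_ceiling divide_nonneg_pos)
  have "(1 - c) ^ k \<le> exp (- c) ^ k" using c01 exp_ge_add_one_self[of "-c"] by (intro power_mono) auto
  also have "\<dots> = exp (- (c * real k))" by (simp add: exp_of_nat_mult[symmetric] mult.commute)
  also have "\<dots> \<le> exp (- ln (real n))" using kge by simp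
  also have "\<dots> = 1 / real n" using n0 by (simp add: exp_minus inverse_eq_divide)
  finally have "(1 - c) ^ k * real (card A) \<le> 1 / real n * N"
    using cardA c01 n0 by (intro mult_mono) auto
  also have "\<dots> \<le> a" unfolding a_def using N0 n0 by (simp add: field_simps)
  finally have rest: "real (card (A - closed_nbhd adj S)) \<le> a" using S(3) by linarith
  obtain S' where S': "S' \<subseteq> A - closed_nbhd adj S" "card S' * (n div 8 + 1) \<le> card (A - closed_nbhd adj S)"
    "\<forall>v\<in>A - closed_nbhd adj S - closed_nbhd adj S'.
       card {u\<in>A - closed_nbhd adj S - closed_nbhd adj S'. adj v u} < n div 8 + 1"
    using greedy_low_degree[of "A - closed_nbhd adj S" "n div 8 + 1" adj] finA by auto
  have eq: "A - closed_nbhd adj S - closed_nbhd adj S' = A - closed_nbhd adj (S \<union> S')"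
    unfolding closed_nbhd_def by blast
  have "real (card S') * (real n / 8) \<le> real (card S') * real (n div 8 + 1)"
    by (intro mult_left_mono) linarith+
  also have "\<dots> = real (card S' * (n div 8 + 1))" by (simp only: of_nat_mult)
  also have "\<dots> \<le> real (card (A - closed_nbhd adj S))" using S'(2) by (simp only: of_nat_le_iff)
  also have "\<dots> \<le> 16 * N / real n" using rest unfolding a_def .
  finally have S'x: "real (card S') \<le> 128 * x"
    unfolding Nx using n0 by (simp add: field_simps power2_eq_square)
  have "real k \<le> ln (real n) / c + 1" unfolding k_def using c0 lnn by (simp add: of_nat_nat)
  also have "ln (real n) / c = 16 * x * ln (real n)"
    unfolding c_def Nx using n0 by (simp add: field_simps)
  finally have kx: "real k \<le> 16 * x * ln (real n) + 1" .
  have lnlog: "ln (real n) \<le> log 2 (real n)"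
    unfolding log_def using lnn ln_2_less_1 by (simp add: field_simps mult_left_le)
  have L1: "1 \<le> log 2 (real n)" using l(5) by linarith
  have "card (S \<union> S') \<le> card S + card S'" by (rule card_Un_le)
  then have "real (card (S \<union> S')) \<le> real k + 128 * x" using S(2) S'x by linarith
  also have "\<dots> \<le> 16 * x * log 2 (real n) + 129 * x"
  proof -
    have "16 * x * ln (real n) \<le> 16 * x * log 2 (real n)" using x1 by (intro mult_left_mono[OF lnlog]) simp
    then show ?thesis using kx x1 by linarith
  qed
  also have "\<dots> \<le> 145 * x * log 2 (real n)"
    using mult_left_mono[OF L1, of "129 * x"] x1 by simp
  finally have "real (card (S \<union> S')) \<le> 145 * x * log 2 (real n)" .
  moreover have "S \<union> S' \<subseteq> A" using S(1) S'(1) by blast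
  ultimately show ?thesis using S'(3) unfolding eq x_def by (intro exI[of _ "S \<union> S'"]) (auto simp: less_Suc_eq_le)
qed

lemma log2_exp_le: "0 \<le> y \<Longrightarrow> log 2 (exp y) \<le> 2 * y"
proof -
  assume y: "0 \<le> y"
  have "(exp 1 :: real) \<le> 4" using exp_le by linarith
  then have "ln (exp 1 :: real) \<le> ln (2 ^ 2)" by (intro ln_mono) auto
  moreover have "ln ((2::real) ^ 2) = 2 * ln 2" by (subst ln_realpow) auto
  ultimately have l2: "1 \<le> 2 * ln (2::real)" by simp
  have "y \<le> 2 * y * ln 2" using mult_left_mono[OF l2 y] by (simp add: mult.commute mult.left_commute)
  then show ?thesis unfolding log_def by (simp add: pos_divide_le_eq)
qed

text \<open>Taking the weight \<open>1 / n ^ j\<close> charges \<open>j * log 2 n\<close> bits per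
  element, while the exponential factor costs \<open>2 * z\<close> bits by
  \<open>log2_exp_le\<close>.\<close>

lemma log2_card_small_subsets_le:
  assumes A: "finite A" and n: "1 \<le> n" and m: "real (card A) \<le> real n ^ j * z"
  shows "log 2 (real (card {T. T \<subseteq> A \<and> card T \<le> k})) \<le> real j * real k * log 2 (real n) + 2 * z"
proof -
  have n0: "0 < real n" using n by simp
  have z: "0 \<le> z" using m n0 by (smt (verit) mult_pos_neg of_nat_0_le_iff zero_less_power)
  let ?y = "1 / real n ^ j"
  have "?y \<le> 1" using n by simp
  then have "real (card {T. T \<subseteq> A \<and> card T \<le> k}) \<le> (real n ^ j) ^ k * exp (?y * real (card A))"
    using card_small_subsets_le_exp[OF A, of ?y k] n0 by simp
  also have "\<dots> \<le> (real n ^ j) ^ k * exp z"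
    using m n0 by (intro mult_left_mono) (simp_all add: field_simps)
  finally have le: "real (card {T. T \<subseteq> A \<and> card T \<le> k}) \<le> (real n ^ j) ^ k * exp z" .
  have "finite {T. T \<subseteq> A \<and> card T \<le> k}" using A by simp
  moreover have "{} \<in> {T. T \<subseteq> A \<and> card T \<le> k}" by simp
  ultimately have "0 < card {T. T \<subseteq> A \<and> card T \<le> k}" using card_gt_0_iff by blast
  then have "log 2 (real (card {T. T \<subseteq> A \<and> card T \<le> k})) \<le> log 2 ((real n ^ j) ^ k * exp z)"
    using le by (intro log_mono) auto
  also have "\<dots> = real j * real k * log 2 (real n) + log 2 (exp z)"
    using n0 by (simp add: log_mult log_nat_power power_mult[symmetric])
  finally show ?thesis using log2_exp_le[OF z] by linarith
qed

section \<open>Bounds for middle and outer ranks\<close>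

lemma compression_large:
  assumes n: "large n" and r: "n \<le> 4 * r" "4 * r \<le> 3 * n"
  shows "compression n r (n div 8) (nat \<lfloor>145 * scale n * log 2 (real n)\<rfloor>)"
proof
  show "1 \<le> n div 8" "n div 8 < r" "r + n div 8 < n" using r largeD(1)[OF n] by linarith+
  fix M assume M: "M \<in> matroids_of_rank n r"
  have "0 < r" "r < n" using r largeD(1)[OF n] by linarith+
  then have "U M \<subseteq> rsets n r" using U_iff[OF M] nonbases_eq[OF M] by blast
  then obtain S where S: "S \<subseteq> U M" "real (card S) \<le> 145 * scale n * log 2 (real n)"
    "\<forall>v\<in>U M - closed_nbhd adj S. card {u\<in>U M - closed_nbhd adj S. adj v u} \<le> n div 8"
    using dominating_set[OF n r] by blast
  then show "\<exists>S\<subseteq>U M. card S \<le> nat \<lfloor>145 * scale n * log 2 (real n)\<rfloor> \<and>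
    (\<forall>v\<in>U M - closed_nbhd adj S. card {u\<in>U M - closed_nbhd adj S. adj v u} \<le> n div 8)"
    by (intro exI[of _ S]) (simp add: le_nat_floor)
qed

text \<open>\<open>G\<close> collects the matroids without loops and coloops whose remainder has at
  most \<open>k\<close> nontrivial components. The exceptions are those with at least
  \<open>k\<close> components, a fraction at most \<open>(1/2) ^ n\<close>, and those with a loop or
  coloop.\<close>

lemma middle_rank:
  assumes n: "large n" and r: "n \<le> 4 * r" "4 * r \<le> 3 * n"
  shows "\<exists>G\<subseteq>matroids_of_rank n r.
    log 2 (real (card (U ` G))) \<le> 7000 * scale n * log 2 (real n) ^ 3 \<and>
    real (card (matroids_of_rank n r - G)) \<le>
      ((1/2) ^ n + 4 * real n * 2 powr (- (real n / 4))) * real (card (matroids_on n))"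
proof -
  note l = largeD[OF n]
  define x where "x = scale n"
  define L where "L = log 2 (real n)"
  define t where "t = nat \<lfloor>145 * x * L\<rfloor>"
  have x1: "1 \<le> x" "real n \<le> x" and L: "3 \<le> L" using l unfolding x_def L_def by auto
  have n0: "1 \<le> n" "0 < real n" using l(1) by linarith+
  interpret compression n r "n div 8" t
    unfolding t_def x_def L_def by (rule compression_large[OF n r])
  have tx: "real t \<le> 145 * x * L" unfolding t_def using x1 L by simp
  \<comment> \<open>Three families at \<open>435 * x * L^2 + 4 * x\<close> bits each and two of
    small sets at \<open>x\<close> bits each give \<open>1305 * x * L^2 + 14 * x\<close>, at most
    \<open>B\<close>.\<close>
  define B where "B = 1319 * x * L^2"
  have xL: "x \<le> x * L" "x * L \<le> x * L^2" "x * L^2 \<le> x * L^3"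
    using x1 L by (simp_all add: power2_eq_square power3_eq_cube mult_left_mono mult_le_cancel_left1)
  have B: "1 \<le> B" "real n \<le> B" unfolding B_def using xL x1 by linarith+
  have NrN: "real (card (rsets n r)) \<le> real n ^ 2 * x"
    using binomial_maximum[of n r] l(6) unfolding card_rsets x_def by (simp add: mult.commute)
  have fam: "log 2 (real (card families)) \<le> 435 * x * L^2 + 4 * x"
  proof -
    \<comment> \<open>Because \<open>2 ^ n\<close> is at most \<open>n ^ 3 * (2 * x)\<close>, a
      listed subset of the ground set costs only \<open>3 * L\<close> bits instead of
      \<open>n\<close>.\<close>
    have "2 ^ n \<le> (real n + 1) * (x * real n ^ 2)"
      using central_binomial_ge[of n] l(6) unfolding x_def by simp
    also have "\<dots> \<le> real n ^ 3 * (2 * x)"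
    proof -
      have "(real n + 1) * (x * real n ^ 2) \<le> (2 * real n) * (x * real n ^ 2)"
        using x1 n0 by (intro mult_right_mono) auto
      then show ?thesis by (simp add: power3_eq_cube power2_eq_square algebra_simps)
    qed
    finally have "real (card (Pow {1..n})) \<le> real n ^ 3 * (2 * x)" by (simp add: card_Pow)
    then have "log 2 (real (card families)) \<le> 3 * real t * L + 2 * (2 * x)"
      unfolding families_def L_def using log2_card_small_subsets_le[of "Pow {1..n}" n 3 "2 * x" t] n0 by simp
    moreover have "real t * L \<le> 145 * x * L * L" using tx L by (intro mult_right_mono) auto
    ultimately show ?thesis by (simp add: power2_eq_square)
  qed
  have pos: "0 < card families"
    using finite_families card_gt_0_iff[of families] unfolding families_def by fastforce
  have small: "real (card small_sets) \<le> x"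
  proof -
    have "4 * (n div 8) \<le> n" by linarith
    from card_quarter_subsets_le[OF this] show ?thesis using l(2) unfolding small_sets_def x_def by linarith
  qed
  have "log 2 (real (card data_range)) = 3 * log 2 (real (card families)) + 2 * real (card small_sets)"
  proof -
    have "log 2 (4::real) = 2" using log_nat_power[of 2 2 2] by simp
    then show ?thesis unfolding card_data_range using pos by (simp add: log_mult log_nat_power)
  qed
  also have "\<dots> \<le> B" unfolding B_def using fam small xL x1 by linarith
  finally have dB: "log 2 (real (card data_range)) \<le> B" .
  have dpos: "0 < real (card data_range)" unfolding card_data_range using pos by simp
  \<comment> \<open>Twice the bit size of the data: the factor \<open>2 ^ k\<close> in
    \<open>many_parts_rare\<close> then outweighs the \<open>2 powr B\<close> data values and still
    leaves \<open>2 powr B\<close>, at least \<open>2 ^ n\<close>.\<close>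
  define k where "k = nat \<lceil>2 * B\<rceil>"
  have k: "2 * B \<le> real k" "real k \<le> 2 * B + 1" unfolding k_def using B by linarith+
  define G where "G = {M \<in> proper. card (parts M) \<le> k}"
  have GM: "G \<subseteq> matroids_of_rank n r" unfolding G_def using properD by blast
  let ?m = "card (matroids_on n)"
  have "log 2 (real (card (U ` G))) \<le> 7000 * x * L^3"
  proof (cases "card (U ` G) = 0")
    \<comment> \<open>\<open>G\<close> may be empty; the logarithm of 0 is then 0.\<close>
    case True
    then show ?thesis using x1 L by (simp add: log_def)
  next
    case False
    let ?T = "{T. T \<subseteq> rsets n r \<and> card T \<le> k}"
    have "real (card (U ` G)) \<le> real (card data_range * card ?T)"
      using few_U[of k] unfolding G_def by (rule of_nat_mono)
    then have le: "real (card (U ` G)) \<le> real (card data_range) * real (card ?T)" by simp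
    have Tpos: "0 < real (card ?T)" using le False dpos by (cases "card ?T = 0") auto
    have "log 2 (real (card (U ` G))) \<le> log 2 (real (card data_range) * real (card ?T))"
      using le False by (intro log_mono) auto
    also have "\<dots> = log 2 (real (card data_range)) + log 2 (real (card ?T))"
      using dpos Tpos by (intro log_mult_pos) auto
    also have "\<dots> \<le> B + (2 * real k * L + 2 * x)"
      using dB log2_card_small_subsets_le[OF rsets_finite n0(1) NrN, of k] unfolding L_def by simp
    also have "\<dots> \<le> 7000 * x * L^3"
    proof -
      \<comment> \<open>Here \<open>2639 = 2 * 1319 + 1\<close>. The total is
        \<open>2 * 2639 + 1319 + 2 = 6599\<close> times \<open>x * L^3\<close>, within the constant
        7000.\<close>
      have "real k * L \<le> (2 * B + x * L^2) * L" using k xL x1 L by (intro mult_right_mono) linarith+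
      also have "\<dots> = 2639 * (x * L^3)" unfolding B_def by (simp add: power2_eq_square power3_eq_cube)
      finally show ?thesis using xL x1 unfolding B_def by linarith
    qed
    finally show ?thesis .
  qed
  moreover have "real (card (matroids_of_rank n r - G)) \<le>
      ((1/2) ^ n + 4 * real n * 2 powr (- (real n / 4))) * real ?m"
  proof -
    let ?P = "{M \<in> proper. k \<le> card (parts M)}"
    have "matroids_of_rank n r - G \<subseteq> ?P \<union> (matroids_of_rank n r - proper)" unfolding G_def by auto
    then have "card (matroids_of_rank n r - G) \<le> card (?P \<union> (matroids_of_rank n r - proper))"
      using finite_proper finite_matroids_of_rank by (intro card_mono) auto
    also have "\<dots> \<le> card ?P + card (matroids_of_rank n r - proper)" by (rule card_Un_le)
    finally have split: "real (card (matroids_of_rank n r - G)) \<le>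
        real (card ?P) + real (card (matroids_of_rank n r - proper))" by linarith
    have "real (card ?P) * 2 ^ k \<le> real (card data_range) * real ?m"
    proof -
      have "card ?P * 2 ^ k \<le> card data_range * card (stable_sets n r)" by (rule many_parts_rare)
      also have "\<dots> \<le> card data_range * ?m" using card_stable_sets_le[OF r(1)] by simp
      finally have "real (card ?P * 2 ^ k) \<le> real (card data_range * ?m)" by (rule of_nat_mono)
      then show ?thesis by simp
    qed
    also have "\<dots> \<le> 2 powr B * real ?m"
      using dB dpos by (intro mult_right_mono) (simp_all add: log_le_iff)
    finally have "real (card ?P) * 2 powr real k \<le> 2 powr B * real ?m" by (simp add: powr_realpow)
    moreover have "real (card ?P) * 2 powr (B + real n) \<le> real (card ?P) * 2 powr real k"
      using k B by (intro mult_left_mono) auto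
    moreover have "real (card ?P) * 2 powr (B + real n) = 2 powr B * (real (card ?P) * 2 ^ n)"
      by (simp add: powr_add powr_realpow)
    ultimately have "2 powr B * (real (card ?P) * 2 ^ n) \<le> 2 powr B * real ?m" by linarith
    then have "real (card ?P) * 2 ^ n \<le> real ?m" by (rule mult_left_le_imp_le) simp
    then have P: "real (card ?P) \<le> (1/2) ^ n * real ?m" by (simp add: field_simps power_divide)
    have "real (card (matroids_of_rank n r - proper) * 2 ^ (r - 1)) \<le> real (2 * n * ?m)"
      using improper_rare by (rule of_nat_mono)
    then have I: "real (card (matroids_of_rank n r - proper)) * 2 ^ (r - 1) \<le> 2 * real n * real ?m" by simp
    have "2 powr (real n / 4) \<le> 2 powr real r" using assms(2) by (intro powr_mono) auto
    also have "\<dots> = 2 * 2 ^ (r - 1)"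
      using r(1) power_Suc[of "2::real" "r - 1"] by (simp add: powr_realpow)
    finally have "real (card (matroids_of_rank n r - proper)) * 2 powr (real n / 4)
        \<le> real (card (matroids_of_rank n r - proper)) * (2 * 2 ^ (r - 1))" by (intro mult_left_mono) auto
    then have "real (card (matroids_of_rank n r - proper)) * 2 powr (real n / 4) \<le> 4 * real n * real ?m"
      using I by linarith
    then have "real (card (matroids_of_rank n r - proper)) \<le> 4 * real n * 2 powr (- (real n / 4)) * real ?m"
      by (simp add: powr_minus field_simps)
    then show ?thesis using split P by (simp add: distrib_right)
  qed
  ultimately show ?thesis using GM unfolding x_def L_def by blast
qed

text \<open>Outside the middle half there are at most \<open>(15/8) ^ n \<le> scale n\<close> sets
  of size \<open>r\<close>, so an arbitrary family of them already fits the bound and no matroid has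
  to be discarded.\<close>

lemma outer_rank:
  assumes n: "large n" and r: "r \<le> n" "\<not> (n \<le> 4 * r \<and> 4 * r \<le> 3 * n)"
  shows "log 2 (real (card (U ` matroids_of_rank n r))) \<le> 7000 * scale n * log 2 (real n) ^ 3"
proof -
  note l = largeD[OF n]
  have quarter: "real (n choose k) \<le> scale n" if "4 * k \<le> n" for k
  proof -
    have "rsets n k \<subseteq> {T. T \<subseteq> {1..n} \<and> card T \<le> k}" unfolding rsets_def by auto
    then have "card (rsets n k) \<le> card {T. T \<subseteq> {1..n} \<and> card T \<le> k}" by (intro card_mono) auto
    then show ?thesis using card_quarter_subsets_le[OF that] l(2) unfolding card_rsets by linarith
  qed
  have b: "real (n choose r) \<le> scale n"
  proof (cases "4 * r \<le> n")
    case False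
    then have "4 * (n - r) \<le> n" using r by linarith
    then show ?thesis using quarter[of "n - r"] binomial_symmetric[OF r(1)] by simp
  qed (rule quarter)
  have "U ` matroids_of_rank n r \<subseteq> Pow (rsets n r)"
    unfolding U_def using nonbases_eq by blast
  then have "card (U ` matroids_of_rank n r) \<le> card (Pow (rsets n r))"
    using rsets_finite by (intro card_mono) auto
  then have le: "card (U ` matroids_of_rank n r) \<le> 2 ^ (n choose r)"
    using rsets_finite by (simp add: card_Pow card_rsets)
  have "log 2 (real (card (U ` matroids_of_rank n r))) \<le> real (n choose r)"
  proof (cases "card (U ` matroids_of_rank n r) = 0")
    case False
    have "real (card (U ` matroids_of_rank n r)) \<le> real (2 ^ (n choose r))" using le by (rule of_nat_mono)
    then have "log 2 (real (card (U ` matroids_of_rank n r))) \<le> log 2 (2 ^ (n choose r))"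
      using False by (intro log_mono) auto
    then show ?thesis by (simp add: log_nat_power)
  qed (simp add: log_def)
  also have "\<dots> \<le> scale n" by (rule b)
  also have "\<dots> \<le> 7000 * scale n * log 2 (real n) ^ 3"
  proof -
    have "(1::real) \<le> log 2 (real n) ^ 3" using l(5) by (intro one_le_power) linarith
    then show ?thesis using mult_left_mono[of 1 "log 2 (real n) ^ 3" "7000 * scale n"] l(4) by linarith
  qed
  finally show ?thesis .
qed

section \<open>Assembling the class over all ranks\<close>

lemma matroids_on_nonempty: "0 < card (matroids_on n)"
proof -
  have "matroid \<lparr>ground = {1..n}, indeps = {{}}\<rparr>" unfolding matroid_def by auto
  then have "\<lparr>ground = {1..n}, indeps = {{}}\<rparr> \<in> matroids_on n" by (intro matroids_onI) auto
  then show ?thesis using finite_matroids_on card_gt_0_iff by blast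
qed

lemma matroids_on_eq: "matroids_on n = (\<Union>r\<le>n. matroids_of_rank n r)"
proof -
  have "r \<le> n" if M: "M \<in> matroids_of_rank n r" for M :: "nat set_system" and r
  proof -
    obtain B where B: "B \<in> indeps M" "card B = r" using matroids_of_rank_base[OF M] by blast
    have "B \<subseteq> {1..n}" using indep_subset_ground[OF matroids_of_rankD(1)[OF M] B(1)]
      matroids_of_rankD(2)[OF M] by simp
    then show ?thesis using card_mono[of "{1..n}" B] B(2) by simp
  qed
  then show ?thesis unfolding matroids_on_def by blast
qed

lemma matroids_of_rank_unique:
  "M \<in> matroids_of_rank n r \<Longrightarrow> M \<in> matroids_of_rank n' r' \<Longrightarrow> n = n' \<and> r = r'"
proof -
  assume "M \<in> matroids_of_rank n r" "M \<in> matroids_of_rank n' r'"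
  then have "{1..n} = {1..n'}" "r = r'" unfolding matroids_of_rank_def by auto
  then show ?thesis by (metis card_atLeastAtMost diff_Suc_1)
qed

theorem theorem1p3:
  shows "\<exists>c::real. \<exists>\<N> \<subseteq> all_matroids. c > 0 \<and> almost_all_matroids \<N> \<and>
    (\<forall>n r::nat. r \<le> n \<longrightarrow>
       log 2 (real (card {U M | M. M \<in> matroids_of_rank n r \<inter> \<N>}))
         \<le> c * ((log 2 (real n))^3 / (real n)^2) * real (n choose (n div 2)))"
proof -
  \<comment> \<open>The exceptional fraction in one rank. It decays exponentially, so summing over
    the \<open>n + 1\<close> ranks still gives a null sequence.\<close>
  define \<epsilon> where "\<epsilon> n = (1/2) ^ n + 4 * real n * 2 powr (- (real n / 4))" for n :: nat
  have \<epsilon>0: "0 \<le> \<epsilon> n" for n unfolding \<epsilon>_def by simp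
  let ?good = "\<lambda>n r G. G \<subseteq> matroids_of_rank n r \<and>
      log 2 (real (card (U ` G))) \<le> 7000 * scale n * log 2 (real n) ^ 3 \<and>
      real (card (matroids_of_rank n r - G)) \<le> \<epsilon> n * real (card (matroids_on n))"
  have "\<exists>G. ?good n r G" if "large n" "r \<le> n" for n r
  proof (cases "n \<le> 4 * r \<and> 4 * r \<le> 3 * n")
    case True
    then show ?thesis using middle_rank[OF that(1)] unfolding \<epsilon>_def by blast
  next
    case False
    then show ?thesis using outer_rank[OF that False] \<epsilon>0 by (intro exI[of _ "matroids_of_rank n r"]) simp
  qed
  then obtain G where G: "\<And>n r. large n \<Longrightarrow> r \<le> n \<Longrightarrow> ?good n r (G n r)" by metis
  \<comment> \<open>The finitely many \<open>n\<close> that are not \<open>large\<close> contribute nothing; there \<open>log 2 0 = 0\<close> applies.\<close>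
  define \<N> where "\<N> = (\<Union>n\<in>{n. large n}. \<Union>r\<le>n. G n r)"
  have N_rank: "matroids_of_rank n r \<inter> \<N> = (if large n then G n r else {})" if r: "r \<le> n" for n r
  proof -
    have "M \<in> G n r \<and> large n" if M: "M \<in> matroids_of_rank n r" "M \<in> \<N>" for M
    proof -
      obtain n' r' where n': "large n'" "r' \<le> n'" "M \<in> G n' r'" using M(2) unfolding \<N>_def by blast
      then have "M \<in> matroids_of_rank n' r'" using G by blast
      then have "n' = n \<and> r' = r" using matroids_of_rank_unique M(1) by blast
      then show ?thesis using n' by simp
    qed
    moreover have "G n r \<subseteq> matroids_of_rank n r \<inter> \<N>" if "large n"
      using G[OF that r] that r unfolding \<N>_def by blast
    ultimately show ?thesis by auto
  qed
  have sub: "\<N> \<subseteq> all_matroids"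
    using G unfolding \<N>_def all_matroids_def matroids_on_def by blast
  have "almost_all_matroids \<N>"
    unfolding almost_all_matroids_def
  proof (rule tendsto_sandwich[where f = "\<lambda>n. 1 - (real n + 1) * \<epsilon> n" and h = "\<lambda>_. 1"])
    show "eventually (\<lambda>n. 1 - (real n + 1) * \<epsilon> n
        \<le> real (card (\<N> \<inter> matroids_on n)) / real (card (matroids_on n))) sequentially"
      using eventually_large
    proof eventually_elim
      case (elim n)
      let ?m = "card (matroids_on n)"
      have "matroids_on n - \<N> \<subseteq> (\<Union>r\<le>n. matroids_of_rank n r - G n r)"
        using N_rank elim unfolding matroids_on_eq by fastforce
      then have "card (matroids_on n - \<N>) \<le> card (\<Union>r\<le>n. matroids_of_rank n r - G n r)"
        using finite_matroids_of_rank by (intro card_mono) auto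
      also have "\<dots> \<le> (\<Sum>r\<le>n. card (matroids_of_rank n r - G n r))" by (rule card_UN_le) simp
      finally have "real (card (matroids_on n - \<N>)) \<le> (\<Sum>r\<le>n. real (card (matroids_of_rank n r - G n r)))"
        by (simp only: of_nat_sum[symmetric] of_nat_le_iff)
      also have "\<dots> \<le> (\<Sum>r\<le>n. \<epsilon> n * real ?m)" using G elim by (intro sum_mono) auto
      also have "\<dots> = (real n + 1) * \<epsilon> n * real ?m" by simp
      finally have bad: "real (card (matroids_on n - \<N>)) \<le> (real n + 1) * \<epsilon> n * real ?m" .
      have "?m = card (\<N> \<inter> matroids_on n) + card (matroids_on n - \<N>)"
        using card_Int_Diff[OF finite_matroids_on, of n \<N>] by (simp add: Int_commute)
      then have "real ?m - (real n + 1) * \<epsilon> n * real ?m \<le> real (card (\<N> \<inter> matroids_on n))"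
        using bad by linarith
      then show ?case using matroids_on_nonempty[of n] by (simp add: field_simps)
    qed
    show "eventually (\<lambda>n. real (card (\<N> \<inter> matroids_on n)) / real (card (matroids_on n)) \<le> 1) sequentially"
      using finite_matroids_on by (intro always_eventually allI divide_le_eq_1[THEN iffD2])
        (auto intro!: card_mono simp: matroids_on_nonempty)
    have "(\<lambda>n. (real n + 1) * (1/2) ^ n) \<longlonglongrightarrow> 0"
      "(\<lambda>n. (real n + 1) * (4 * real n * 2 powr (- (real n / 4)))) \<longlonglongrightarrow> 0" by real_asymp+
    then have "(\<lambda>n. 1 - ((real n + 1) * (1/2) ^ n + (real n + 1) * (4 * real n * 2 powr (- (real n / 4)))))
        \<longlonglongrightarrow> 1 - (0 + 0)" by (intro tendsto_intros)
    then show "(\<lambda>n. 1 - (real n + 1) * \<epsilon> n) \<longlonglongrightarrow> 1" unfolding \<epsilon>_def distrib_left by simp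
  qed simp
  moreover have "log 2 (real (card {U M | M. M \<in> matroids_of_rank n r \<inter> \<N>}))
      \<le> 7000 * ((log 2 (real n))^3 / (real n)^2) * real (n choose (n div 2))" if r: "r \<le> n" for n r
  proof -
    have eq: "{U M | M. M \<in> matroids_of_rank n r \<inter> \<N>} = U ` (matroids_of_rank n r \<inter> \<N>)" by blast
    show ?thesis
    proof (cases "large n")
      case True
      then show ?thesis using G[OF True r] unfolding eq unfolding N_rank[OF r] scale_def by (simp add: algebra_simps)
    next
      case False
      \<comment> \<open>For \<open>n\<close> not \<open>large\<close> the left side is
        \<open>log 2 0 = 0\<close>, so a nonnegative right side suffices; at \<open>n = 0\<close>
        this again uses \<open>log 2 0 = 0\<close>.\<close>
      have "0 \<le> log 2 (real n)" by (cases "n = 0") (auto simp: log_def)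
      then show ?thesis using False unfolding eq unfolding N_rank[OF r] by (simp add: log_def)
    qed
  qed
  ultimately show ?thesis using sub by (intro exI[of _ 7000] exI[of _ \<N>]) auto
qed

end
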